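(* Let $p,q$ be distinct odd primes with $q>p$. In each of the following cases the quasitriangular structures on the group algebra $\Bbbk\beta_i$ are exactly the elements $R=\sum_{g,h\in K}w(g,h)\,e_g\otimes e_h$, where $K$ is the indicated abelian normal subgroup and $w$ is a bicharacter on $K$ satisfying the indicated conditions. (1) $\beta_3=\langle s,t\mid s^{q^2}=t^p=1,\ tst^{-1}=s^m\rangle$, where $p\mid(q^2-1)$, $m^p\equiv1\pmod{q^2}$, $m\not\equiv1\pmod{q^2}$: $K=\langle s\rangle$ and $w(s^m,s^m)=w(s,s)$. (2) $\beta_4=\langle s,t,u\mid s^q=t^q=u^p=1,\ tst^{-1}=s,\ usu^{-1}=s,\ utu^{-1}=t^m\rangle$, where $p\mid(q-1)$, $m^p\equiv1\pmod q$, $m\not\equiv1\pmod q$: $K=\langle s,t\rangle$ and $w(s,t^m)=w(s,t)$, $w(t^m,s)=w(t,s)$, $w(t^m,t^m)=w(t,t)$. (3) $\beta_5=\langle s,t,u\mid s^q=t^q=u^p=1,\ tst^{-1}=s,\ usu^{-1}=s^m,\ utu^{-1}=t^m\rangle$, where $p\mid(q-1)$, $m^p\equiv1\pmod q$, $m\not\equiv1\pmod q$: $K=\langle s,t\rangle$ and $w(s^m,s^m)=w(s,s)$, $w(s^m,t^m)=w(s,t)$, $w(t^m,s^m)=w(t,s)$, $w(t^m,t^m)=w(t,t)$. (4) $\beta_6=\langle s,t,u\mid s^q=t^q=u^p=1,\ tst^{-1}=s,\ usu^{-1}=s^m,\ utu^{-1}=t^n\rangle$, where $p\mid(q-1)$,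 $m^p\equiv n^p\equiv1\pmod q$, $m\not\equiv1$, $n\not\equiv1$, $m\not\equiv n\pmod q$: $K=\langle s,t\rangle$ and $w(s^m,s^m)=w(s,s)$, $w(s^m,t^n)=w(s,t)$, $w(t^n,s^m)=w(t,s)$, $w(t^n,t^n)=w(t,t)$. (5) $\beta_7=\langle s,t,u\mid s^q=t^q=u^p=1,\ tst^{-1}=s,\ usu^{-1}=t,\ utu^{-1}=s^mt^n,\ u^psu^{-p}=s\rangle$, where $p\mid(q+1)$ and $m,n\in\mathbb{N}$ are such that $\beta_7$ has order $pq^2$: $K=\langle s,t\rangle$ and $w(t,t)=w(s,s)$, $w(t,s^mt^n)=w(s,t)$, $w(s^mt^n,t)=w(t,s)$, $w(s^mt^n,s^mt^n)=w(t,t)$.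
   Context: $\Bbbk$ is an algebraically closed field of characteristic $0$. A quasitriangular structure on a Hopf algebra $H$ is an invertible $R\in H\otimes H$ with $(\Delta\otimes \mathrm{Id})(R)=R_{13}R_{23}$, $(\mathrm{Id}\otimes\Delta)(R)=R_{13}R_{12}$ and $\Delta^{op}(h)R=R\Delta(h)$ for all $h\in H$. A bicharacter on an abelian group $K$ is a map $w:K\times K\to\Bbbk^\times$ multiplicative in each variable. The elements $e_g$ ($g\in K$) are the primitive orthogonal idempotents of $\Bbbk K$, labelled by $K$ through an identification of $K$ with its character group: fix a group isomorphism $K\to\widehat K$, $g\mapsto\chi_g$, compatible with the conjugation action of the ambient group in the sense that $\chi_{v g v^{-1}}(x)=\chi_g(vxv^{-1})$ for all $g,x\in K$, where $v=t$ in case (1) and $v=u$ in cases (2)-(5) (such an isomorphism exists), and set $e_g=|K|^{-1}\sum_{x\in K}\chi_g(x)x$. In cases (1)-(4) one may take the standard one, e.g. $\chi_{s^it^j}(s^kt^l)=\omega^{ik+jl}$ with $\omega$ a primitive $q$th root of unity in cases (2)-(4), and $\chi_{s^i}(s^k)=\omega^{ik}$ with $\omega$ a primitive $q^2$th root of unity in case (1). *)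

theory Defs
  imports
    "HOL-Algebra.Ring"
    "HOL-Algebra.Generated_Groups"
    "HOL-Number_Theory.Cong"
    "HOL-Computational_Algebra.Primes"
    "HOL-Computational_Algebra.Polynomial"
    "HOL-Library.Poly_Mapping"
begin

section \<open>Groups given by generators and relations\<close>

text \<open>The generating set is the whole type \<open>'x\<close>. A letter \<open>(x, True)\<close> stands for \<open>x\<close> and
  \<open>(x, False)\<close> for its formal inverse; a relation \<open>l = r\<close> is the pair of words \<open>(l, r)\<close>.\<close>

type_synonym 'x word = "('x \<times> bool) list"

inductive word_cong :: "('x word \<times> 'x word) set \<Rightarrow> 'x word \<Rightarrow> 'x word \<Rightarrow> bool"
  for Rel :: "('x word \<times> 'x word) set" where
  wc_rel: "(l, r) \<in> Rel \<Longrightarrow> word_cong Rel l r"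
| wc_cancel: "word_cong Rel [(x, b), (x, \<not> b)] []"
| wc_context: "word_cong Rel u v \<Longrightarrow> word_cong Rel (a @ u @ b) (a @ v @ b)"
| wc_refl: "word_cong Rel u u"
| wc_sym: "word_cong Rel u v \<Longrightarrow> word_cong Rel v u"
| wc_trans: "word_cong Rel u v \<Longrightarrow> word_cong Rel v w \<Longrightarrow> word_cong Rel u w"

definition word_class :: "('x word \<times> 'x word) set \<Rightarrow> 'x word \<Rightarrow> 'x word set" where
  "word_class Rel u = {v. word_cong Rel u v}"

definition presented_group :: "('x word \<times> 'x word) set \<Rightarrow> 'x word set monoid" where
  "presented_group Rel =
     \<lparr>carrier = range (word_class Rel),
      monoid.mult = (\<lambda>A B. \<Union>a\<in>A. \<Union>b\<in>B. word_class Rel (a @ b)),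
      one = word_class Rel []\<rparr>"

definition generator :: "('x word \<times> 'x word) set \<Rightarrow> 'x \<Rightarrow> 'x word set" where
  "generator Rel x = word_class Rel [(x, True)]"

definition wpow :: "'x \<Rightarrow> nat \<Rightarrow> 'x word" where
  "wpow x n = replicate n (x, True)"

definition winv :: "'x word \<Rightarrow> 'x word" where
  "winv u = rev (map (\<lambda>(x, b). (x, \<not> b)) u)"

definition wconj :: "'x word \<Rightarrow> 'x word \<Rightarrow> 'x word" where
  "wconj v u = v @ u @ winv v"

subsection \<open>The groups of order \<open>p q\<^sup>2\<close>\<close>

datatype gen2 = S2 | T2
datatype gen3 = S3 | T3 | U3

definition rels3 :: "nat \<Rightarrow> nat \<Rightarrow> nat \<Rightarrow> (gen2 word \<times> gen2 word) set" where
  "rels3 p q m =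
     {(wpow S2 (q\<^sup>2), []), (wpow T2 p, []),
      (wconj (wpow T2 1) (wpow S2 1), wpow S2 m)}"

definition rels4 :: "nat \<Rightarrow> nat \<Rightarrow> nat \<Rightarrow> (gen3 word \<times> gen3 word) set" where
  "rels4 p q m =
     {(wpow S3 q, []), (wpow T3 q, []), (wpow U3 p, []),
      (wconj (wpow T3 1) (wpow S3 1), wpow S3 1),
      (wconj (wpow U3 1) (wpow S3 1), wpow S3 1),
      (wconj (wpow U3 1) (wpow T3 1), wpow T3 m)}"

definition rels5 :: "nat \<Rightarrow> nat \<Rightarrow> nat \<Rightarrow> (gen3 word \<times> gen3 word) set" where
  "rels5 p q m =
     {(wpow S3 q, []), (wpow T3 q, []), (wpow U3 p, []),
      (wconj (wpow T3 1) (wpow S3 1), wpow S3 1),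
      (wconj (wpow U3 1) (wpow S3 1), wpow S3 m),
      (wconj (wpow U3 1) (wpow T3 1), wpow T3 m)}"

definition rels6 :: "nat \<Rightarrow> nat \<Rightarrow> nat \<Rightarrow> nat \<Rightarrow> (gen3 word \<times> gen3 word) set" where
  "rels6 p q m n =
     {(wpow S3 q, []), (wpow T3 q, []), (wpow U3 p, []),
      (wconj (wpow T3 1) (wpow S3 1), wpow S3 1),
      (wconj (wpow U3 1) (wpow S3 1), wpow S3 m),
      (wconj (wpow U3 1) (wpow T3 1), wpow T3 n)}"

definition rels7 :: "nat \<Rightarrow> nat \<Rightarrow> nat \<Rightarrow> nat \<Rightarrow> (gen3 word \<times> gen3 word) set" where
  "rels7 p q m n =
     {(wpow S3 q, []), (wpow T3 q, []), (wpow U3 p, []),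
      (wconj (wpow T3 1) (wpow S3 1), wpow S3 1),
      (wconj (wpow U3 1) (wpow S3 1), wpow T3 1),
      (wconj (wpow U3 1) (wpow T3 1), wpow S3 m @ wpow T3 n),
      (wconj (wpow U3 p) (wpow S3 1), wpow S3 1)}"

section \<open>Group algebras and their tensor powers\<close>

text \<open>\<open>'a \<Rightarrow>\<^sub>0 'k\<close> is the vector space with basis \<open>'a\<close>. The tensor product of the spaces with
  bases \<open>'a\<close> and \<open>'b\<close> is the space with basis \<open>'a \<times> 'b\<close>, the pair \<open>(x, y)\<close> being the basis
  vector \<open>x \<otimes> y\<close>. The tensor powers of \<open>kG\<close>, with their componentwise multiplication, are thus
  the group algebras of \<open>G \<times> G\<close> and \<open>G \<times> G \<times> G\<close>.\<close>

definition scale :: "'k::field \<Rightarrow> ('a \<Rightarrow>\<^sub>0 'k) \<Rightarrow> ('a \<Rightarrow>\<^sub>0 'k)" where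
  "scale c f = Poly_Mapping.map ((*) c) f"

definition group_algebra :: "('a, 'c) monoid_scheme \<Rightarrow> ('a \<Rightarrow>\<^sub>0 'k::field) ring" where
  "group_algebra G =
     \<lparr>carrier = {f. Poly_Mapping.keys f \<subseteq> carrier G},
      monoid.mult = (\<lambda>f g. \<Sum>x\<in>Poly_Mapping.keys f. \<Sum>y\<in>Poly_Mapping.keys g.
        Poly_Mapping.single (x \<otimes>\<^bsub>G\<^esub> y) (Poly_Mapping.lookup f x * Poly_Mapping.lookup g y)),
      one = Poly_Mapping.single \<one>\<^bsub>G\<^esub> 1,
      zero = 0,
      add = (+)\<rparr>"

definition tensor :: "('a \<Rightarrow>\<^sub>0 'k::field) \<Rightarrow> ('b \<Rightarrow>\<^sub>0 'k) \<Rightarrow> ('a \<times> 'b \<Rightarrow>\<^sub>0 'k)" where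
  "tensor f g = (\<Sum>x\<in>Poly_Mapping.keys f. \<Sum>y\<in>Poly_Mapping.keys g.
     Poly_Mapping.single (x, y) (Poly_Mapping.lookup f x * Poly_Mapping.lookup g y))"

text \<open>The linear map sending each basis vector \<open>x\<close> to the basis vector \<open>\<phi> x\<close>. All structure maps
  below are of this form, since the comultiplication of \<open>kG\<close> is \<open>g \<mapsto> g \<otimes> g\<close> on group elements.\<close>

definition lin_map :: "('a \<Rightarrow> 'b) \<Rightarrow> ('a \<Rightarrow>\<^sub>0 'k::field) \<Rightarrow> ('b \<Rightarrow>\<^sub>0 'k)" where
  "lin_map \<phi> f = (\<Sum>x\<in>Poly_Mapping.keys f. Poly_Mapping.single (\<phi> x) (Poly_Mapping.lookup f x))"

definition comult :: "('a \<Rightarrow>\<^sub>0 'k::field) \<Rightarrow> ('a \<times> 'a \<Rightarrow>\<^sub>0 'k)" where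
  "comult = lin_map (\<lambda>x. (x, x))"

definition comult_op :: "('a \<Rightarrow>\<^sub>0 'k::field) \<Rightarrow> ('a \<times> 'a \<Rightarrow>\<^sub>0 'k)" where
  "comult_op h = lin_map prod.swap (comult h)"

definition comult_id :: "('a \<times> 'a \<Rightarrow>\<^sub>0 'k::field) \<Rightarrow> ('a \<times> 'a \<times> 'a \<Rightarrow>\<^sub>0 'k)" where
  "comult_id = lin_map (\<lambda>(x, y). (x, x, y))"

definition id_comult :: "('a \<times> 'a \<Rightarrow>\<^sub>0 'k::field) \<Rightarrow> ('a \<times> 'a \<times> 'a \<Rightarrow>\<^sub>0 'k)" where
  "id_comult = lin_map (\<lambda>(x, y). (x, y, y))"

definition leg12 :: "('a, 'c) monoid_scheme \<Rightarrow> ('a \<times> 'a \<Rightarrow>\<^sub>0 'k::field) \<Rightarrow> ('a \<times> 'a \<times> 'a \<Rightarrow>\<^sub>0 'k)" where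
  "leg12 G = lin_map (\<lambda>(x, y). (x, y, \<one>\<^bsub>G\<^esub>))"

definition leg13 :: "('a, 'c) monoid_scheme \<Rightarrow> ('a \<times> 'a \<Rightarrow>\<^sub>0 'k::field) \<Rightarrow> ('a \<times> 'a \<times> 'a \<Rightarrow>\<^sub>0 'k)" where
  "leg13 G = lin_map (\<lambda>(x, y). (x, \<one>\<^bsub>G\<^esub>, y))"

definition leg23 :: "('a, 'c) monoid_scheme \<Rightarrow> ('a \<times> 'a \<Rightarrow>\<^sub>0 'k::field) \<Rightarrow> ('a \<times> 'a \<times> 'a \<Rightarrow>\<^sub>0 'k)" where
  "leg23 G = lin_map (\<lambda>(x, y). (\<one>\<^bsub>G\<^esub>, x, y))"

definition quasitriangular :: "('a, 'c) monoid_scheme \<Rightarrow> ('a \<times> 'a \<Rightarrow>\<^sub>0 'k::field) \<Rightarrow> bool" where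
  "quasitriangular G R \<longleftrightarrow>
     R \<in> Units (group_algebra (G \<times>\<times> G)) \<and>
     comult_id R = leg13 G R \<otimes>\<^bsub>group_algebra (G \<times>\<times> G \<times>\<times> G)\<^esub> leg23 G R \<and>
     id_comult R = leg13 G R \<otimes>\<^bsub>group_algebra (G \<times>\<times> G \<times>\<times> G)\<^esub> leg12 G R \<and>
     (\<forall>h\<in>carrier (group_algebra G :: ('a \<Rightarrow>\<^sub>0 'k) ring).
        comult_op h \<otimes>\<^bsub>group_algebra (G \<times>\<times> G)\<^esub> R = R \<otimes>\<^bsub>group_algebra (G \<times>\<times> G)\<^esub> comult h)"

section \<open>Characters, bicharacters and idempotents\<close>

definition field_units :: "'k::field monoid" where
  "field_units = \<lparr>carrier = UNIV - {0}, monoid.mult = (*), one = 1\<rparr>"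

definition subgrp :: "('a, 'c) monoid_scheme \<Rightarrow> 'a set \<Rightarrow> ('a, 'c) monoid_scheme" where
  "subgrp G K = G\<lparr>carrier := K\<rparr>"

definition bicharacter ::
  "('a, 'c) monoid_scheme \<Rightarrow> 'a set \<Rightarrow> ('a \<Rightarrow> 'a \<Rightarrow> 'k::field) \<Rightarrow> bool" where
  "bicharacter G K w \<longleftrightarrow>
     (\<forall>g\<in>K. (\<lambda>h. w g h) \<in> hom (subgrp G K) field_units) \<and>
     (\<forall>h\<in>K. (\<lambda>g. w g h) \<in> hom (subgrp G K) field_units)"

text \<open>Characters are functions on \<open>K\<close>, hence taken \<open>undefined\<close> outside \<open>K\<close>.\<close>

definition character_group :: "('a, 'c) monoid_scheme \<Rightarrow> 'a set \<Rightarrow> ('a \<Rightarrow> 'k::field) monoid" where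
  "character_group G K =
     \<lparr>carrier = hom (subgrp G K) field_units \<inter> extensional K,
      monoid.mult = (\<lambda>\<psi> \<phi>. \<lambda>x\<in>K. \<psi> x * \<phi> x),
      one = (\<lambda>x\<in>K. 1)\<rparr>"

text \<open>Identification of \<open>K\<close> with its character group, compatible with conjugation by \<open>v\<close>.\<close>

definition char_identification ::
  "('a, 'c) monoid_scheme \<Rightarrow> 'a set \<Rightarrow> 'a \<Rightarrow> ('a \<Rightarrow> 'a \<Rightarrow> 'k::field) \<Rightarrow> bool" where
  "char_identification G K v \<chi> \<longleftrightarrow>
     \<chi> \<in> iso (subgrp G K) (character_group G K) \<and>
     (\<forall>g\<in>K. \<forall>x\<in>K. \<chi> (v \<otimes>\<^bsub>G\<^esub> g \<otimes>\<^bsub>G\<^esub> inv\<^bsub>G\<^esub> v) x = \<chi> g (v \<otimes>\<^bsub>G\<^esub> x \<otimes>\<^bsub>G\<^esub> inv\<^bsub>G\<^esub> v))"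

definition idem :: "'a set \<Rightarrow> ('a \<Rightarrow> 'a \<Rightarrow> 'k::field) \<Rightarrow> 'a \<Rightarrow> ('a \<Rightarrow>\<^sub>0 'k)" where
  "idem K \<chi> g = scale (inverse (of_nat (card K))) (\<Sum>x\<in>K. Poly_Mapping.single x (\<chi> g x))"

definition R_of ::
  "'a set \<Rightarrow> ('a \<Rightarrow> 'a \<Rightarrow> 'k::field) \<Rightarrow> ('a \<Rightarrow> 'a \<Rightarrow> 'k) \<Rightarrow> ('a \<times> 'a \<Rightarrow>\<^sub>0 'k)" where
  "R_of K \<chi> w = (\<Sum>g\<in>K. \<Sum>h\<in>K. scale (w g h) (tensor (idem K \<chi> g) (idem K \<chi> h)))"

end

theory Submission
  imports Defs
begin

text \<open>Pairing the axioms of a quasitriangular structure \<open>R\<close> with functions on \<open>G \<times> G \<times> G\<close> shows that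
  each of the two supports of \<open>R\<close> consists of pairwise commuting elements and is closed under
  conjugation. In \<open>G = K \<langle>v\<rangle>\<close> with \<open>K\<close> abelian and normal of order prime to \<open>p\<close>, with \<open>v\<^sup>p = 1\<close> and \<open>v\<close>
  not centralizing \<open>K\<close>, such a set lies in \<open>K\<close>. Hence \<open>R\<close> is an element of \<open>kK \<otimes> kK\<close> and is determined by its
  Fourier transform \<open>w(g, h) = (\<chi>\<^sub>g \<otimes> \<chi>\<^sub>h)(R)\<close>. The two hexagon axioms say that \<open>w\<close> is
  multiplicative in each variable, invertibility makes it non-zero, and commutation with \<open>\<Delta>(v)\<close> is
  invariance of \<open>w\<close> under conjugation by \<open>v\<close>.\<close>

section \<open>Pairing with functions\<close>

text \<open>The two hexagon axioms play different roles in the commutation of a support. Slicing R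
  by a function \<xi> on the first factor gives the element (\<xi> \<otimes> id)(R). Since the
  comultiplication of kG is cocommutative, one axiom forces all slices to commute; the other shows
  that every group element in the second support is, up to a nonzero scalar, itself a slice.
  Coprimality of p and the exponent of K then turns commuting with one's own conjugates into lying
  in K. The other obstacle is that the groups are words modulo relations, where a collapse of s^m to
  s is not visibly excluded. The order of K is never computed: it is enough that K is finite, that
  x^N = 1 on K, and that v moves a generator. For four families an action on the integers modulo N
  shows the latter, for the fifth the given order of the group does. Finally, e_g is built from the
  values of \<chi>_g and not of its inverse, so the transform of R is first read off at inverse
  labels; a bicharacter does not see a simultaneous inversion.\<close>

definition pairing :: "('a \<Rightarrow>\<^sub>0 'k::field) \<Rightarrow> ('a \<Rightarrow> 'k) \<Rightarrow> 'k" where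
  "pairing f \<phi> = (\<Sum>x\<in>Poly_Mapping.keys f. Poly_Mapping.lookup f x * \<phi> x)"

lemma pairing_superset:
  assumes "finite S" "Poly_Mapping.keys f \<subseteq> S"
  shows "pairing f \<phi> = (\<Sum>x\<in>S. Poly_Mapping.lookup f x * \<phi> x)"
  unfolding pairing_def
  by (rule sum.mono_neutral_left) (use assms in \<open>auto simp: in_keys_iff\<close>)

lemma pairing_cong:
  "(\<And>x. x \<in> Poly_Mapping.keys f \<Longrightarrow> \<phi> x = \<psi> x) \<Longrightarrow> pairing f \<phi> = pairing f \<psi>"
  by (simp add: pairing_def)

lemma pairing_zero_left [simp]: "pairing 0 \<phi> = 0"
  by (simp add: pairing_def)

lemma pairing_add_left: "pairing (f + g) \<phi> = pairing f \<phi> + pairing g \<phi>"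
proof -
  let ?S = "Poly_Mapping.keys f \<union> Poly_Mapping.keys g"
  have "pairing (f + g) \<phi> = (\<Sum>x\<in>?S. Poly_Mapping.lookup (f + g) x * \<phi> x)"
    by (rule pairing_superset) (simp_all add: Poly_Mapping.keys_add)
  also have "\<dots> = (\<Sum>x\<in>?S. Poly_Mapping.lookup f x * \<phi> x) + (\<Sum>x\<in>?S. Poly_Mapping.lookup g x * \<phi> x)"
    by (simp add: lookup_add distrib_right sum.distrib)
  also have "\<dots> = pairing f \<phi> + pairing g \<phi>"
    by (simp add: pairing_superset [where S = ?S])
  finally show ?thesis .
qed

lemma pairing_sum_left: "pairing (\<Sum>i\<in>I. f i) \<phi> = (\<Sum>i\<in>I. pairing (f i) \<phi>)"
  by (induction I rule: infinite_finite_induct) (simp_all add: pairing_add_left)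

lemma pairing_single [simp]: "pairing (Poly_Mapping.single x c) \<phi> = c * \<phi> x"
  by (simp add: pairing_superset [where S = "{x}"])

lemma pairing_scale [simp]: "pairing (scale c f) \<phi> = c * pairing f \<phi>"
proof -
  have "Poly_Mapping.keys (scale c f) \<subseteq> Poly_Mapping.keys f"
    by (auto simp: scale_def in_keys_iff map.rep_eq)
  then have "pairing (scale c f) \<phi>
      = (\<Sum>x\<in>Poly_Mapping.keys f. Poly_Mapping.lookup (scale c f) x * \<phi> x)"
    by (intro pairing_superset) auto
  also have "\<dots> = c * pairing f \<phi>"
    unfolding pairing_def sum_distrib_left
    by (rule sum.cong) (auto simp: scale_def map.rep_eq in_keys_iff)
  finally show ?thesis .
qed

lemma pairing_sum_right: "pairing f (\<lambda>x. \<Sum>i\<in>I. \<phi> i x) = (\<Sum>i\<in>I. pairing f (\<phi> i))"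
  unfolding pairing_def sum_distrib_left by (rule sum.swap)

lemma pairing_mult_left: "pairing f (\<lambda>x. c * \<phi> x) = c * pairing f \<phi>"
  unfolding pairing_def sum_distrib_left by (simp add: mult_ac)

lemma pairing_mult_right: "pairing f (\<lambda>x. \<phi> x * c) = pairing f \<phi> * c"
  unfolding pairing_def sum_distrib_right by (simp add: mult_ac)

lemma pairing_swap:
  "pairing f (\<lambda>x. pairing g (\<phi> x)) = pairing g (\<lambda>y. pairing f (\<lambda>x. \<phi> x y))"
  unfolding pairing_def sum_distrib_left
  by (subst sum.swap) (simp add: mult_ac)

lemma lookup_eq_pairing: "Poly_Mapping.lookup f x = pairing f (\<lambda>y. if y = x then 1 else 0)"
  by (simp add: pairing_def if_distrib [of "\<lambda>z. _ * z"] in_keys_iff cong: if_cong)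

lemma poly_mapping_eq_iff_pairing: "f = g \<longleftrightarrow> (\<forall>\<phi>. pairing f \<phi> = pairing g \<phi>)"
  by (metis lookup_eq_pairing poly_mapping_eqI)

text \<open>Bounds the support of an image or a product from its pairing formula alone, with no
  bookkeeping of which coefficients cancel.\<close>

lemma keys_subset_iff_pairing:
  "Poly_Mapping.keys f \<subseteq> S \<longleftrightarrow> (\<forall>\<phi>. (\<forall>x\<in>S. \<phi> x = 0) \<longrightarrow> pairing f \<phi> = 0)"
proof
  assume "Poly_Mapping.keys f \<subseteq> S"
  then show "\<forall>\<phi>. (\<forall>x\<in>S. \<phi> x = 0) \<longrightarrow> pairing f \<phi> = 0"
    by (auto simp: pairing_def intro!: sum.neutral)
next
  assume *: "\<forall>\<phi>. (\<forall>x\<in>S. \<phi> x = 0) \<longrightarrow> pairing f \<phi> = 0"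
  show "Poly_Mapping.keys f \<subseteq> S"
  proof (rule subsetI, rule ccontr)
    fix x assume x: "x \<in> Poly_Mapping.keys f" "x \<notin> S"
    then have "Poly_Mapping.lookup f x = 0"
      unfolding lookup_eq_pairing by (intro * [rule_format]) auto
    with x show False by (simp add: in_keys_iff)
  qed
qed

text \<open>This is what the pairing is for. Comultiplications, legs and flips are induced by maps
  of basis elements, so they become substitutions in the test function, while tensors and products
  become iterated pairings.\<close>

lemma pairing_lin_map: "pairing (lin_map \<alpha> f) \<phi> = pairing f (\<lambda>x. \<phi> (\<alpha> x))"
  by (simp add: lin_map_def pairing_sum_left) (simp add: pairing_def)

lemma pairing_tensor:
  "pairing (tensor f g) \<phi> = pairing f (\<lambda>x. pairing g (\<lambda>y. \<phi> (x, y)))"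
  by (simp add: tensor_def pairing_sum_left) (simp add: pairing_def sum_distrib_left mult_ac)

lemma pairing_group_algebra_mult:
  "pairing (f \<otimes>\<^bsub>group_algebra G\<^esub> g) \<phi>
   = pairing f (\<lambda>x. pairing g (\<lambda>y. \<phi> (x \<otimes>\<^bsub>G\<^esub> y)))"
  by (simp add: group_algebra_def pairing_sum_left) (simp add: pairing_def sum_distrib_left mult_ac)

lemma carrier_group_algebra:
  "carrier (group_algebra G) = {f. Poly_Mapping.keys f \<subseteq> carrier G}"
  by (simp add: group_algebra_def)

lemma one_group_algebra: "\<one>\<^bsub>group_algebra G\<^esub> = Poly_Mapping.single \<one>\<^bsub>G\<^esub> 1"
  by (simp add: group_algebra_def)

lemma pairing_group_algebra_one: "pairing \<one>\<^bsub>group_algebra G\<^esub> \<phi> = \<phi> \<one>\<^bsub>G\<^esub>"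
  by (simp add: one_group_algebra)

lemma mult_DirProd' [simp]: "a \<otimes>\<^bsub>G \<times>\<times> H\<^esub> b = (fst a \<otimes>\<^bsub>G\<^esub> fst b, snd a \<otimes>\<^bsub>H\<^esub> snd b)"
  by (cases a; cases b) simp

text \<open>Each axiom becomes an identity that may be instantiated with any test function. The
  commutation axiom is linear in h, so group elements suffice there. Test functions are curried, so
  that one depending on a single leg can be supplied directly.\<close>

lemma quasitriangular_iff_pairing:
  assumes "group G"
  shows "quasitriangular G R \<longleftrightarrow>
    R \<in> Units (group_algebra (G \<times>\<times> G)) \<and>
    (\<forall>\<phi>. pairing R (\<lambda>(x, y). \<phi> x x y)
       = pairing R (\<lambda>(x, y). pairing R (\<lambda>(x', y'). \<phi> x x' (y \<otimes>\<^bsub>G\<^esub> y')))) \<and>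
    (\<forall>\<phi>. pairing R (\<lambda>(x, y). \<phi> x y y)
       = pairing R (\<lambda>(x, y). pairing R (\<lambda>(x', y'). \<phi> (x \<otimes>\<^bsub>G\<^esub> x') y' y))) \<and>
    (\<forall>g\<in>carrier G. \<forall>\<phi>. pairing R (\<lambda>(x, y). \<phi> (g \<otimes>\<^bsub>G\<^esub> x) (g \<otimes>\<^bsub>G\<^esub> y))
       = pairing R (\<lambda>(x, y). \<phi> (x \<otimes>\<^bsub>G\<^esub> g) (y \<otimes>\<^bsub>G\<^esub> g)))"
proof (cases "R \<in> Units (group_algebra (G \<times>\<times> G))")
  case False
  then show ?thesis by (simp add: quasitriangular_def)
next
  case True
  interpret group G by fact
  \<comment> \<open>Invertibility already confines the support, and this has to come first: the legs
    insert \<open>\<one>\<close>, which is neutral only on the carrier.\<close>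
  have keys: "Poly_Mapping.keys R \<subseteq> carrier G \<times> carrier G"
    using True by (auto simp: Units_def carrier_group_algebra)
  have 1: "comult_id R = leg13 G R \<otimes>\<^bsub>group_algebra (G \<times>\<times> G \<times>\<times> G)\<^esub> leg23 G R \<longleftrightarrow>
     (\<forall>\<phi>. pairing R (\<lambda>(x, y). \<phi> x x y)
       = pairing R (\<lambda>(x, y). pairing R (\<lambda>(x', y'). \<phi> x x' (y \<otimes>\<^bsub>G\<^esub> y'))))" (is "?L \<longleftrightarrow> (\<forall>\<phi>. ?E \<phi>)" is "_ \<longleftrightarrow> ?Q")
  proof -
    have "pairing (comult_id R) \<phi> = pairing R (\<lambda>(x, y). \<phi> (x, x, y))" for \<phi>
      by (simp add: comult_id_def pairing_lin_map case_prod_unfold)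
    moreover have "pairing (leg13 G R \<otimes>\<^bsub>group_algebra (G \<times>\<times> G \<times>\<times> G)\<^esub> leg23 G R) \<phi>
        = pairing R (\<lambda>(x, y). pairing R (\<lambda>(x', y'). \<phi> (x, x', y \<otimes>\<^bsub>G\<^esub> y')))" for \<phi>
      unfolding pairing_group_algebra_mult leg13_def leg23_def pairing_lin_map case_prod_unfold
      using keys by (intro pairing_cong arg_cong [where f = \<phi>]) auto
    ultimately have "?L \<longleftrightarrow> (\<forall>\<phi>. pairing R (\<lambda>(x, y). \<phi> (x, x, y))
       = pairing R (\<lambda>(x, y). pairing R (\<lambda>(x', y'). \<phi> (x, x', y \<otimes>\<^bsub>G\<^esub> y'))))" (is "_ \<longleftrightarrow> ?P")
      by (simp add: poly_mapping_eq_iff_pairing)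
    also have "?P \<longleftrightarrow> ?Q"
    proof
      assume P: ?P
      show ?Q
      proof
        fix \<phi> :: "'a \<Rightarrow> 'a \<Rightarrow> 'a \<Rightarrow> 'c"
        show "?E \<phi>"
          using P [rule_format, of "\<lambda>(x, y, z). \<phi> x y z"] by (simp only: prod.case)
      qed
    next
      assume Q: ?Q
      show ?P
        by (rule allI) (rule Q [rule_format, of "\<lambda>x y z. _ (x, y, z)"])
    qed
    finally show ?thesis .
  qed
  have 2: "id_comult R = leg13 G R \<otimes>\<^bsub>group_algebra (G \<times>\<times> G \<times>\<times> G)\<^esub> leg12 G R \<longleftrightarrow>
     (\<forall>\<phi>. pairing R (\<lambda>(x, y). \<phi> x y y)
       = pairing R (\<lambda>(x, y). pairing R (\<lambda>(x', y'). \<phi> (x \<otimes>\<^bsub>G\<^esub> x') y' y)))" (is "?L \<longleftrightarrow> (\<forall>\<phi>. ?E \<phi>)" is "_ \<longleftrightarrow> ?Q")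
  proof -
    have "pairing (id_comult R) \<phi> = pairing R (\<lambda>(x, y). \<phi> (x, y, y))" for \<phi>
      by (simp add: id_comult_def pairing_lin_map case_prod_unfold)
    moreover have "pairing (leg13 G R \<otimes>\<^bsub>group_algebra (G \<times>\<times> G \<times>\<times> G)\<^esub> leg12 G R) \<phi>
        = pairing R (\<lambda>(x, y). pairing R (\<lambda>(x', y'). \<phi> (x \<otimes>\<^bsub>G\<^esub> x', y', y)))" for \<phi>
      unfolding pairing_group_algebra_mult leg13_def leg12_def pairing_lin_map case_prod_unfold
      using keys by (intro pairing_cong arg_cong [where f = \<phi>]) auto
    ultimately have "?L \<longleftrightarrow> (\<forall>\<phi>. pairing R (\<lambda>(x, y). \<phi> (x, y, y))
       = pairing R (\<lambda>(x, y). pairing R (\<lambda>(x', y'). \<phi> (x \<otimes>\<^bsub>G\<^esub> x', y', y))))" (is "_ \<longleftrightarrow> ?P")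
      by (simp add: poly_mapping_eq_iff_pairing)
    also have "?P \<longleftrightarrow> ?Q"
    proof
      assume P: ?P
      show ?Q
      proof
        fix \<phi> :: "'a \<Rightarrow> 'a \<Rightarrow> 'a \<Rightarrow> 'c"
        show "?E \<phi>"
          using P [rule_format, of "\<lambda>(x, y, z). \<phi> x y z"] by (simp only: prod.case)
      qed
    next
      assume Q: ?Q
      show ?P
        by (rule allI) (rule Q [rule_format, of "\<lambda>x y z. _ (x, y, z)"])
    qed
    finally show ?thesis .
  qed
  have 3: "(\<forall>h\<in>carrier (group_algebra G :: ('a \<Rightarrow>\<^sub>0 'c) ring).
        comult_op h \<otimes>\<^bsub>group_algebra (G \<times>\<times> G)\<^esub> R = R \<otimes>\<^bsub>group_algebra (G \<times>\<times> G)\<^esub> comult h) \<longleftrightarrow>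
    (\<forall>g\<in>carrier G. \<forall>\<phi>. pairing R (\<lambda>(x, y). \<phi> (g \<otimes>\<^bsub>G\<^esub> x) (g \<otimes>\<^bsub>G\<^esub> y))
       = pairing R (\<lambda>(x, y). \<phi> (x \<otimes>\<^bsub>G\<^esub> g) (y \<otimes>\<^bsub>G\<^esub> g)))" (is "?L \<longleftrightarrow> ?Q")
  proof -
    have l: "pairing (comult_op h \<otimes>\<^bsub>group_algebra (G \<times>\<times> G)\<^esub> R) \<phi>
        = pairing h (\<lambda>g. pairing R (\<lambda>(x, y). \<phi> (g \<otimes>\<^bsub>G\<^esub> x, g \<otimes>\<^bsub>G\<^esub> y)))" for h \<phi>
      by (simp add: pairing_group_algebra_mult comult_op_def comult_def pairing_lin_map case_prod_unfold)
    have r: "pairing (R \<otimes>\<^bsub>group_algebra (G \<times>\<times> G)\<^esub> comult h) \<phi>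
        = pairing h (\<lambda>g. pairing R (\<lambda>(x, y). \<phi> (x \<otimes>\<^bsub>G\<^esub> g, y \<otimes>\<^bsub>G\<^esub> g)))" for h \<phi>
      by (subst pairing_swap)
        (simp add: pairing_group_algebra_mult comult_def pairing_lin_map case_prod_unfold)
    show ?thesis
    proof
      assume L: ?L
      show ?Q
      proof (intro ballI allI)
        fix g \<phi> assume "g \<in> carrier G"
        then have "Poly_Mapping.single g (1::'c) \<in> carrier (group_algebra G)"
          by (simp add: carrier_group_algebra)
        with L have "pairing (comult_op (Poly_Mapping.single g 1) \<otimes>\<^bsub>group_algebra (G \<times>\<times> G)\<^esub> R) (case_prod \<phi>)
          = pairing (R \<otimes>\<^bsub>group_algebra (G \<times>\<times> G)\<^esub> comult (Poly_Mapping.single g 1)) (case_prod \<phi>)"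
          by simp
        then show "pairing R (\<lambda>(x, y). \<phi> (g \<otimes>\<^bsub>G\<^esub> x) (g \<otimes>\<^bsub>G\<^esub> y))
           = pairing R (\<lambda>(x, y). \<phi> (x \<otimes>\<^bsub>G\<^esub> g) (y \<otimes>\<^bsub>G\<^esub> g))"
          by (simp add: l r)
      qed
    next
      assume Q: ?Q
      show ?L
      proof
        fix h :: "'a \<Rightarrow>\<^sub>0 'c" assume "h \<in> carrier (group_algebra G)"
        then have "Poly_Mapping.keys h \<subseteq> carrier G"
          by (simp add: carrier_group_algebra)
        then show "comult_op h \<otimes>\<^bsub>group_algebra (G \<times>\<times> G)\<^esub> R = R \<otimes>\<^bsub>group_algebra (G \<times>\<times> G)\<^esub> comult h"
          unfolding poly_mapping_eq_iff_pairing l r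
          by (intro allI pairing_cong Q [rule_format, of _ "\<lambda>x y. _ (x, y)"]) auto
      qed
    qed
  qed
  show ?thesis
    unfolding quasitriangular_def 1 2 3 ..
qed

section \<open>The supports of a quasitriangular structure\<close>

text \<open>The binary operations are arbitrary, so that the lemma also applies to the flipped element,
  which satisfies the same identities for the opposite multiplication.\<close>

lemma support_commute:
  assumes H1: "\<And>\<phi>. pairing R (\<lambda>(x, y). \<phi> x x y)
      = pairing R (\<lambda>(x, y). pairing R (\<lambda>(x', y'). \<phi> x x' (m y y')))"
    and H2: "\<And>\<phi>. pairing R (\<lambda>(x, y). \<phi> x y y)
      = pairing R (\<lambda>(x, y). pairing R (\<lambda>(x', y'). \<phi> (n x x') y' y))"
    and 1: "(z1, y1) \<in> Poly_Mapping.keys R" and 2: "(z2, y2) \<in> Poly_Mapping.keys R"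
  shows "m y1 y2 = m y2 y1"
proof -
  \<comment> \<open>The slicing function: with \<xi> = \<open>c z y\<close>, the slice (\<xi>
    \<otimes> id)(R) is r y, where r is the coefficient of R at (z, y). This is the content of
    \<open>coeff\<close>, read off from \<open>H2\<close> with an indicator in the outer two
    arguments.\<close>
  define c where "c z y x' = pairing R (\<lambda>(x, y'). if n x x' = z \<and> y' = y then 1 else 0)" for z y x'
  \<comment> \<open>The left side of \<open>H1\<close> evaluates \<phi> at equal first arguments, so
    it is unchanged when they are exchanged. Hence slices commute.\<close>
  have comm: "pairing R (\<lambda>(x, y). pairing R (\<lambda>(x', y'). \<phi> x x' (m y y')))
      = pairing R (\<lambda>(x, y). pairing R (\<lambda>(x', y'). \<phi> x x' (m y' y)))" for \<phi>
  proof -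
    have "pairing R (\<lambda>(x, y). pairing R (\<lambda>(x', y'). \<phi> x x' (m y y')))
        = pairing R (\<lambda>(x, y). pairing R (\<lambda>(x', y'). \<phi> x' x (m y y')))"
      unfolding H1 [symmetric, of \<phi>] H1 [symmetric, of "\<lambda>x x'. \<phi> x' x"] ..
    also have "\<dots> = pairing R (\<lambda>(x, y). pairing R (\<lambda>(x', y'). \<phi> x x' (m y' y)))"
      unfolding case_prod_unfold by (rule pairing_swap)
    finally show ?thesis .
  qed
  have coeff: "Poly_Mapping.lookup R (z, y) * \<eta> y = pairing R (\<lambda>(x', y'). c z y x' * \<eta> y')" for z y \<eta>
  proof -
    have "Poly_Mapping.lookup R (z, y) * \<eta> y
        = pairing R (\<lambda>(x, y'). (if x = z \<and> y' = y then 1 else 0) * \<eta> y')"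
      unfolding lookup_eq_pairing pairing_mult_right [symmetric] by (rule pairing_cong) (auto split: if_splits)
    also have "\<dots> = pairing R (\<lambda>(x, y'). pairing R (\<lambda>(x', y'').
        (if n x x' = z \<and> y' = y then 1 else 0) * \<eta> y''))"
      by (rule H2 [of "\<lambda>a b d. (if a = z \<and> d = y then 1 else 0) * \<eta> b"])
    also have "\<dots> = pairing R (\<lambda>(x', y'). c z y x' * \<eta> y')"
      unfolding case_prod_unfold
      by (subst pairing_swap) (simp add: c_def case_prod_unfold pairing_mult_right)
    finally show ?thesis .
  qed
  let ?r1 = "Poly_Mapping.lookup R (z1, y1)" and ?r2 = "Poly_Mapping.lookup R (z2, y2)"
  have coeff2: "?r1 * (?r2 * h y1 y2)
      = pairing R (\<lambda>(x, y). pairing R (\<lambda>(x', y'). c z1 y1 x * (c z2 y2 x' * h y y')))" for h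
    unfolding coeff [of _ _ "h y1"]
    unfolding coeff [of _ _ "\<lambda>y. pairing R (\<lambda>(x', y'). c z2 y2 x' * h y y')"]
    by (simp add: case_prod_unfold pairing_mult_left)
  \<comment> \<open>An indicator of one of the two products: as both coefficients are nonzero, it
    must not vanish at the other product either.\<close>
  let ?\<psi> = "\<lambda>z. if z = m y1 y2 then 1 else 0"
  have "?r1 * (?r2 * ?\<psi> (m y1 y2)) = ?r1 * (?r2 * ?\<psi> (m y2 y1))"
    unfolding coeff2 [of "\<lambda>a b. ?\<psi> (m a b)"] coeff2 [of "\<lambda>a b. ?\<psi> (m b a)"]
    by (rule comm [of "\<lambda>x x' y. c z1 y1 x * (c z2 y2 x' * ?\<psi> y)"])
  moreover have "?r1 \<noteq> 0" "?r2 \<noteq> 0"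
    using 1 2 by (simp_all add: in_keys_iff)
  ultimately show ?thesis
    by (auto split: if_splits)
qed

text \<open>Commuting with g \<otimes> g makes the coefficients of R constant along simultaneous
  conjugation by g. An indicator at (g x, g y) reads this off.\<close>

lemma (in group) support_conj:
  assumes inv_R: "\<And>\<phi>. pairing R (\<lambda>(x, y). \<phi> (g \<otimes> x) (g \<otimes> y)) = pairing R (\<lambda>(x, y). \<phi> (x \<otimes> g) (y \<otimes> g))"
    and keys: "Poly_Mapping.keys R \<subseteq> carrier G \<times> carrier G"
    and g: "g \<in> carrier G" and xy: "(x, y) \<in> Poly_Mapping.keys R"
  shows "(g \<otimes> x \<otimes> inv g, g \<otimes> y \<otimes> inv g) \<in> Poly_Mapping.keys R"
proof -
  have x: "x \<in> carrier G" and y: "y \<in> carrier G"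
    using keys xy by auto
  have *: "a \<otimes> g = g \<otimes> b \<longleftrightarrow> a = g \<otimes> b \<otimes> inv g" if "a \<in> carrier G" "b \<in> carrier G" for a b
    using that g by (metis inv_solve_right m_closed)
  have in_carrier: "a \<in> carrier G \<and> b \<in> carrier G" if "(a, b) \<in> Poly_Mapping.keys R" for a b
    using keys that by auto
  have "Poly_Mapping.lookup R (x, y)
      = pairing R (\<lambda>(a, b). if g \<otimes> a = g \<otimes> x \<and> g \<otimes> b = g \<otimes> y then 1 else 0)"
    unfolding lookup_eq_pairing using x y g by (intro pairing_cong) (auto dest!: in_carrier split: if_splits)
  also have "\<dots> = pairing R (\<lambda>(a, b). if a \<otimes> g = g \<otimes> x \<and> b \<otimes> g = g \<otimes> y then 1 else 0)"
    by (rule inv_R [of "\<lambda>a b. if a = g \<otimes> x \<and> b = g \<otimes> y then 1 else 0"])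
  also have "\<dots> = Poly_Mapping.lookup R (g \<otimes> x \<otimes> inv g, g \<otimes> y \<otimes> inv g)"
    unfolding lookup_eq_pairing using x y g by (intro pairing_cong) (auto dest!: in_carrier simp: * split: if_splits)
  finally show ?thesis
    using xy by (simp add: in_keys_iff)
qed

lemma (in group) pow_cong:
  assumes "x \<in> carrier G" "x [^] (n::nat) = \<one>" "[i = j] (mod n)"
  shows "x [^] i = x [^] j"
proof -
  have "x [^] l = x [^] (l mod n)" for l :: nat
  proof -
    have "x [^] l = x [^] (n * (l div n) + l mod n)" by simp
    also have "\<dots> = (x [^] n) [^] (l div n) \<otimes> x [^] (l mod n)"
      using assms(1) by (simp only: nat_pow_mult nat_pow_pow)
    finally show ?thesis using assms by simp
  qed
  then show ?thesis using assms(3) unfolding cong_def by metis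
qed

text \<open>The shape shared by the five families, with v = t in case (1) and v = u in the others.
  \<open>N\<close> is q^2 in case (1) and q otherwise; as a mere bound on element orders it covers
  cyclic and noncyclic K alike. The assumption \<open>v_noncentral\<close> is the one that cannot be
  read off from the relations.\<close>

locale coprime_extension = group +
  fixes K v p N
  assumes K: "subgroup K G" and finite_K: "finite K"
    and K_comm: "\<lbrakk>x \<in> K; y \<in> K\<rbrakk> \<Longrightarrow> x \<otimes> y = y \<otimes> x"
    and K_exponent: "x \<in> K \<Longrightarrow> x [^] (N::nat) = \<one>"
    and v: "v \<in> carrier G" and v_pow: "v [^] (p::nat) = \<one>"
    and p: "prime p" and coprime: "coprime p N"
    and K_conj: "x \<in> K \<Longrightarrow> v \<otimes> x \<otimes> inv v \<in> K"
    and generated: "carrier G \<subseteq> generate G (insert v K)"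
    and v_noncentral: "\<exists>k\<in>K. v \<otimes> k \<noteq> k \<otimes> v"
begin

lemma K_carrier: "x \<in> K \<Longrightarrow> x \<in> carrier G"
  using K by (rule subgroup.mem_carrier)

lemma K_closed: "\<lbrakk>x \<in> K; y \<in> K\<rbrakk> \<Longrightarrow> x \<otimes> y \<in> K" "x \<in> K \<Longrightarrow> inv x \<in> K" "\<one> \<in> K"
  using K by (auto intro: subgroup.m_closed subgroup.m_inv_closed subgroup.one_closed)

lemma K_conj_pow: "x \<in> K \<Longrightarrow> v [^] (i::nat) \<otimes> x \<otimes> inv (v [^] i) \<in> K"
proof (induction i)
  case 0
  then show ?case by (simp add: K_carrier)
next
  case (Suc i)
  have "v [^] Suc i \<otimes> x \<otimes> inv (v [^] Suc i) = v \<otimes> (v [^] i \<otimes> x \<otimes> inv (v [^] i)) \<otimes> inv v"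
    using v Suc.prems K_carrier unfolding nat_pow_Suc2 [OF v] by (simp add: inv_mult_group m_assoc)
  then show ?case using K_conj Suc by simp
qed

lemma decomp:
  assumes "g \<in> carrier G" shows "\<exists>k\<in>K. \<exists>i::nat. g = k \<otimes> v [^] i"
proof -
  have "g \<in> generate G (insert v K)"
    using assms generated by blast
  then show ?thesis
  proof induction
    case one
    show ?case
      by (rule bexI [OF _ K_closed(3)], rule exI [where x = 0]) simp
  next
    case (incl h)
    then show ?case
    proof (cases "h = v")
      case True
      then show ?thesis
        using v by (intro bexI [OF _ K_closed(3)] exI [where x = 1]) simp
    next
      case False
      then show ?thesis
        using incl K_carrier by (intro bexI [where x = h] exI [where x = 0]) auto
    qed
  next
    case (inv h)
    then show ?case
    proof (cases "h = v")
      case True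
      \<comment> \<open>The inverse of v is a natural power of v, so natural exponents suffice in
        the decomposition.\<close>
      have "v [^] (p - 1) \<otimes> v = \<one>"
        using v v_pow p by (metis Suc_diff_1 nat_pow_Suc prime_gt_0_nat)
      then have "inv v = v [^] (p - 1)"
        using v by (intro inv_equality) auto
      then show ?thesis
        using v True by (intro bexI [OF _ K_closed(3)] exI [where x = "p - 1"]) simp
    next
      case False
      then show ?thesis
        using inv K_carrier K_closed by (intro bexI [where x = "inv h"] exI [where x = 0]) auto
    qed
  next
    case (eng h1 h2)
    then obtain k1 i1 k2 i2 where h: "k1 \<in> K" "h1 = k1 \<otimes> v [^] (i1::nat)"
      "k2 \<in> K" "h2 = k2 \<otimes> v [^] (i2::nat)" by blast
    let ?u = "v [^] i1"
    have cancel: "inv ?u \<otimes> (?u \<otimes> w) = w" if "w \<in> carrier G" for w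
      using that v by (simp add: m_assoc [symmetric])
    have "h1 \<otimes> h2 = k1 \<otimes> (?u \<otimes> k2 \<otimes> inv ?u) \<otimes> (?u \<otimes> v [^] i2)"
      using h v K_carrier by (simp add: m_assoc cancel)
    also have "\<dots> = k1 \<otimes> (?u \<otimes> k2 \<otimes> inv ?u) \<otimes> v [^] (i1 + i2)"
      using v by (simp add: nat_pow_mult)
    finally show ?case
      using h K_closed(1) K_conj_pow by blast
  qed
qed

lemma K_normal:
  assumes "g \<in> carrier G" "x \<in> K" shows "g \<otimes> x \<otimes> inv g \<in> K"
proof -
  obtain k i where k: "k \<in> K" "g = k \<otimes> v [^] (i::nat)"
    using decomp assms by blast
  then have "g \<otimes> x \<otimes> inv g = k \<otimes> (v [^] i \<otimes> x \<otimes> inv (v [^] i)) \<otimes> inv k"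
    using v assms K_carrier by (simp add: inv_mult_group m_assoc)
  then show ?thesis using K_closed K_conj_pow k(1) assms by simp
qed

text \<open>Computes powers in the quotient G/K without forming it.\<close>

lemma pow_mod_K: "k \<in> K \<Longrightarrow> \<exists>k'\<in>K. (k \<otimes> v [^] i) [^] (j::nat) = k' \<otimes> v [^] (i * j :: nat)"
proof (induction j)
  case 0
  then show ?case using K_closed(3) by (auto intro: bexI [where x = \<one>])
next
  case (Suc j)
  then obtain k' where k': "k' \<in> K" "(k \<otimes> v [^] i) [^] j = k' \<otimes> v [^] (i * j)"
    by blast
  let ?u = "v [^] (i * j)"
  have cancel: "inv ?u \<otimes> (?u \<otimes> w) = w" if "w \<in> carrier G" for w
    using that v by (simp add: m_assoc [symmetric])
  have "(k \<otimes> v [^] i) [^] Suc j = k' \<otimes> ?u \<otimes> (k \<otimes> v [^] i)"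
    by (simp add: k')
  also have "\<dots> = (k' \<otimes> (?u \<otimes> k \<otimes> inv ?u)) \<otimes> (?u \<otimes> v [^] i)"
    using k' Suc.prems v K_carrier by (simp add: m_assoc cancel)
  also have "?u \<otimes> v [^] i = v [^] (i * Suc j)"
    using v by (simp add: nat_pow_mult add.commute)
  finally show ?case
    using K_closed(1) K_conj_pow k'(1) Suc.prems by blast
qed

text \<open>For \<open>x \<in> X\<close> and \<open>k \<in> K\<close>, the commutator \<open>c = [x, k] \<in> K\<close> commutes with \<open>x\<close>, so
  \<open>x\<^sup>p \<in> K\<close> gives \<open>c\<^sup>p = 1\<close> and hence \<open>c = 1\<close>. Outside \<open>K\<close>, this would make \<open>v\<close> centralize \<open>K\<close>.\<close>

lemma commuting_class_subset:
  assumes X: "X \<subseteq> carrier G"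
    and comm: "\<And>x y. \<lbrakk>x \<in> X; y \<in> X\<rbrakk> \<Longrightarrow> x \<otimes> y = y \<otimes> x"
    and conj: "\<And>g x. \<lbrakk>g \<in> carrier G; x \<in> X\<rbrakk> \<Longrightarrow> g \<otimes> x \<otimes> inv g \<in> X"
  shows "X \<subseteq> K"
proof
  fix x assume x: "x \<in> X"
  then have xG: "x \<in> carrier G" using X by blast
  obtain k0 i where k0: "k0 \<in> K" "x = k0 \<otimes> v [^] (i::nat)"
    using decomp xG by blast
  have central: "x \<otimes> k = k \<otimes> x" if k: "k \<in> K" for k
  proof -
    have kG: "k \<in> carrier G" using k by (rule K_carrier)
    define c where "c = x \<otimes> k \<otimes> inv x \<otimes> inv k"
    have c: "c \<in> K" unfolding c_def by (intro K_closed K_normal xG k)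
    then have cG: "c \<in> carrier G" by (rule K_carrier)
    let ?y = "k \<otimes> x \<otimes> inv k"
    have y: "?y \<in> X" "?y \<in> carrier G" using conj x kG xG by simp_all
    \<comment> \<open>Both closure properties of \<open>X\<close> meet here: \<open>?y\<close> is a
      conjugate of x, so it lies in \<open>X\<close> and commutes with x. Therefore c, a product of
      x and the inverse of \<open>?y\<close>, commutes with x.\<close>
    have c_eq: "c = x \<otimes> inv ?y"
      using xG kG by (simp add: c_def inv_mult_group m_assoc)
    have "x \<otimes> inv ?y = inv ?y \<otimes> x"
      using comm [OF x y(1)] xG y(2) by (metis inv_closed inv_solve_left inv_solve_right m_assoc m_closed)
    then have xc: "x \<otimes> c = c \<otimes> x"
      unfolding c_eq using xG y(2) by (metis inv_closed m_assoc)
    have xk: "x \<otimes> k = c \<otimes> k \<otimes> x"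
      using xG kG by (simp add: c_def m_assoc)
    have xcj: "x \<otimes> c [^] j = c [^] j \<otimes> x" for j :: nat
    proof (induction j)
      case (Suc j)
      have "x \<otimes> c [^] Suc j = x \<otimes> c [^] j \<otimes> c"
        using xG cG by (simp add: m_assoc)
      also have "\<dots> = c [^] Suc j \<otimes> x"
        using xG cG xc Suc by (simp add: m_assoc)
      finally show ?case .
    qed (use xG in simp)
    \<comment> \<open>Each passage of x across k releases one factor c, which can be moved to the
      front because it commutes with x.\<close>
    have pow: "x [^] j \<otimes> k = c [^] j \<otimes> k \<otimes> x [^] j" for j :: nat
    proof (induction j)
      case 0
      then show ?case using kG by simp
    next
      case (Suc j)
      have "x [^] Suc j \<otimes> k = x \<otimes> (c [^] j \<otimes> k \<otimes> x [^] j)"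
        unfolding nat_pow_Suc2 [OF xG] using Suc xG kG by (simp add: m_assoc)
      also have "\<dots> = (x \<otimes> c [^] j) \<otimes> k \<otimes> x [^] j"
        using xG kG cG by (simp add: m_assoc)
      also have "\<dots> = c [^] j \<otimes> (x \<otimes> k) \<otimes> x [^] j"
        using xG kG cG by (simp add: xcj m_assoc)
      also have "\<dots> = c [^] Suc j \<otimes> k \<otimes> x [^] Suc j"
        unfolding xk nat_pow_Suc2 [OF xG] using xG kG cG by (simp add: m_assoc)
      finally show ?case .
    qed
    have "x [^] p \<in> K"
    proof -
      obtain k' where "k' \<in> K" "x [^] p = k' \<otimes> v [^] (i * p)"
        using pow_mod_K [OF k0(1)] k0(2) by blast
      moreover have "v [^] (i * p) = \<one>"
        using v v_pow by (metis mult.commute nat_pow_one nat_pow_pow)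
      ultimately show ?thesis using K_carrier by simp
    qed
    then have "x [^] p \<otimes> k = k \<otimes> x [^] p"
      using K_comm k by simp
    then have "c [^] p \<otimes> k \<otimes> x [^] p = k \<otimes> x [^] p"
      using pow [of p] by simp
    then have "c [^] p = \<one>"
      using cG kG xG by simp
    then have "c [^] (p * j) = \<one>" for j
      using cG by (simp add: nat_pow_pow [symmetric])
    \<comment> \<open>An inverse of p modulo the exponent of K, so that c = c^(p j) = 1.\<close>
    moreover obtain j where "[p * j = 1] (mod N)"
      using cong_solve_coprime_nat [OF coprime] by auto
    then have "c [^] (p * j) = c [^] (1::nat)"
      using pow_cong cG K_exponent [OF c] by blast
    ultimately have "c = \<one>"
      using cG by simp
    then show ?thesis
      using xk xG kG by simp
  qed
  \<comment> \<open>Both x and \<open>k0\<close> centralize K, hence so does v^i. If p did not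
    divide i, then v would be a power of v^i and would centralize K as well.\<close>
  have vi: "v [^] i \<otimes> k = k \<otimes> v [^] i" if "k \<in> K" for k
  proof -
    have eq: "v [^] i = inv k0 \<otimes> x"
      using k0 v K_carrier by (simp add: m_assoc [symmetric])
    have "inv k0 \<otimes> x \<otimes> k = inv k0 \<otimes> k \<otimes> x"
      using central [OF that] xG that k0(1) K_carrier by (simp add: m_assoc)
    also have "inv k0 \<otimes> k = k \<otimes> inv k0"
      using K_comm K_closed k0(1) that by simp
    finally show ?thesis
      unfolding eq using xG that k0(1) K_carrier by (simp add: m_assoc)
  qed
  have vij: "v [^] (i * j) \<otimes> k = k \<otimes> v [^] (i * j)" if "k \<in> K" for k j
  proof (induction j)
    case 0
    then show ?case using that K_carrier by simp
  next
    case (Suc j)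
    have kG: "k \<in> carrier G" using that by (rule K_carrier)
    have eq: "v [^] (i * Suc j) = v [^] i \<otimes> v [^] (i * j)"
      using v by (simp add: nat_pow_mult)
    have "v [^] i \<otimes> v [^] (i * j) \<otimes> k = v [^] i \<otimes> (k \<otimes> v [^] (i * j))"
      using Suc v kG by (simp add: m_assoc)
    also have "\<dots> = k \<otimes> (v [^] i \<otimes> v [^] (i * j))"
      using vi [OF that] v kG by (simp add: m_assoc [symmetric])
    finally show ?case unfolding eq .
  qed
  have "p dvd i"
  proof (rule ccontr)
    assume "\<not> p dvd i"
    then have "coprime i p"
      using p by (metis coprime_commute prime_imp_coprime)
    then obtain j where j: "[i * j = 1] (mod p)"
      using cong_solve_coprime_nat by auto
    then have "v [^] (i * j) = v [^] (1::nat)"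
      using pow_cong v v_pow by blast
    then have "v \<otimes> k = k \<otimes> v" if "k \<in> K" for k
      using vij [OF that, of j] v by simp
    then show False using v_noncentral by blast
  qed
  then have "v [^] i = \<one>"
    using v v_pow by (metis dvdE nat_pow_one nat_pow_pow)
  then show "x \<in> K"
    using k0 K_carrier by simp
qed

lemma keys_subset_K:
  assumes QT: "quasitriangular G R"
  shows "Poly_Mapping.keys R \<subseteq> K \<times> K"
proof -
  have keys: "Poly_Mapping.keys R \<subseteq> carrier G \<times> carrier G"
    using QT by (auto simp: quasitriangular_def Units_def carrier_group_algebra)
  have H1: "pairing R (\<lambda>(x, y). \<phi> x x y)
      = pairing R (\<lambda>(x, y). pairing R (\<lambda>(x', y'). \<phi> x x' (y \<otimes> y')))"
    and H2: "pairing R (\<lambda>(x, y). \<phi> x y y)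
      = pairing R (\<lambda>(x, y). pairing R (\<lambda>(x', y'). \<phi> (x \<otimes> x') y' y))" for \<phi>
    using QT unfolding quasitriangular_iff_pairing [OF is_group] by blast+
  have conj: "(g \<otimes> x \<otimes> inv g, g \<otimes> y \<otimes> inv g) \<in> Poly_Mapping.keys R"
    if "g \<in> carrier G" "(x, y) \<in> Poly_Mapping.keys R" for g x y
    using QT that unfolding quasitriangular_iff_pairing [OF is_group]
    by (intro support_conj keys) blast+
  have "snd ` Poly_Mapping.keys R \<subseteq> K"
  proof (rule commuting_class_subset)
    show "x \<otimes> y = y \<otimes> x" if "x \<in> snd ` Poly_Mapping.keys R" "y \<in> snd ` Poly_Mapping.keys R" for x y
      using that support_commute [OF H1 H2] by force
    show "g \<otimes> x \<otimes> inv g \<in> snd ` Poly_Mapping.keys R"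
      if "g \<in> carrier G" "x \<in> snd ` Poly_Mapping.keys R" for g x
      using that conj by force
  qed (use keys in auto)
  moreover have "fst ` Poly_Mapping.keys R \<subseteq> K"
  proof (rule commuting_class_subset)
    \<comment> \<open>The flip exchanges the hexagon identities: \<open>H1'\<close> comes from
      \<open>H2\<close>, and \<open>H2'\<close> from \<open>H1\<close>.\<close>
    let ?R = "lin_map prod.swap R"
    have pR: "pairing ?R \<phi> = pairing R (\<lambda>(x, y). \<phi> (y, x))" for \<phi>
      by (simp add: pairing_lin_map case_prod_unfold prod.swap_def)
    have kR: "(y, x) \<in> Poly_Mapping.keys ?R" if "(x, y) \<in> Poly_Mapping.keys R" for x y
    proof -
      have "Poly_Mapping.lookup ?R (y, x) = Poly_Mapping.lookup R (x, y)"
        unfolding lookup_eq_pairing pR by (rule pairing_cong) (auto split: if_splits)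
      with that show ?thesis by (simp add: in_keys_iff)
    qed
    have H1': "pairing ?R (\<lambda>(x, y). \<phi> x x y)
      = pairing ?R (\<lambda>(x, y). pairing ?R (\<lambda>(x', y'). \<phi> x x' (y' \<otimes> y)))" for \<phi>
    proof -
      have "pairing ?R (\<lambda>(x, y). \<phi> x x y) = pairing R (\<lambda>(x, y). \<phi> y y x)"
        by (simp add: pR)
      also have "\<dots> = pairing R (\<lambda>(x, y). pairing R (\<lambda>(x', y'). \<phi> y' y (x \<otimes> x')))"
        by (rule H2 [of "\<lambda>a b d. \<phi> b d a"])
      also have "\<dots> = pairing ?R (\<lambda>(x, y). pairing ?R (\<lambda>(x', y'). \<phi> x x' (y' \<otimes> y)))"
        unfolding pR case_prod_unfold by (subst pairing_swap) simp
      finally show ?thesis .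
    qed
    have H2': "pairing ?R (\<lambda>(x, y). \<phi> x y y)
      = pairing ?R (\<lambda>(x, y). pairing ?R (\<lambda>(x', y'). \<phi> (x' \<otimes> x) y' y))" for \<phi>
    proof -
      have "pairing ?R (\<lambda>(x, y). \<phi> x y y) = pairing R (\<lambda>(x, y). \<phi> y x x)"
        by (simp add: pR)
      also have "\<dots> = pairing R (\<lambda>(x, y). pairing R (\<lambda>(x', y'). \<phi> (y \<otimes> y') x x'))"
        by (rule H1 [of "\<lambda>a b d. \<phi> d a b"])
      also have "\<dots> = pairing ?R (\<lambda>(x, y). pairing ?R (\<lambda>(x', y'). \<phi> (x' \<otimes> x) y' y))"
        unfolding pR case_prod_unfold by (subst pairing_swap) simp
      finally show ?thesis .
    qed
    show "x \<otimes> y = y \<otimes> x" if "x \<in> fst ` Poly_Mapping.keys R" "y \<in> fst ` Poly_Mapping.keys R" for x y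
      using that support_commute [OF H1' H2'] kR by force
    show "g \<otimes> x \<otimes> inv g \<in> fst ` Poly_Mapping.keys R"
      if "g \<in> carrier G" "x \<in> fst ` Poly_Mapping.keys R" for g x
      using that conj by force
  qed (use keys in auto)
  ultimately show ?thesis by force
qed

end

section \<open>Fourier analysis on \<open>K\<close>\<close>

text \<open>Spanning without independence is enough: by linearity, an element supported in
  \<open>S\<close> is determined by its pairings with the family.\<close>

definition spans :: "'i set \<Rightarrow> ('i \<Rightarrow> 'a \<Rightarrow> 'k::field) \<Rightarrow> 'a set \<Rightarrow> bool" where
  "spans I \<xi> S \<longleftrightarrow> (\<forall>\<phi>. \<exists>c. \<forall>x\<in>S. \<phi> x = (\<Sum>i\<in>I. c i * \<xi> i x))"

text \<open>Expand \<phi> (x, y) in x for each fixed y, then expand each coefficient as a function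
  of y.\<close>

lemma spans_prod:
  fixes \<xi> :: "'i \<Rightarrow> 'a \<Rightarrow> 'k::field" and \<eta> :: "'j \<Rightarrow> 'b \<Rightarrow> 'k"
  assumes "spans I \<xi> S" "spans J \<eta> T"
  shows "spans (I \<times> J) (\<lambda>(i, j) (x, y). \<xi> i x * \<eta> j y) (S \<times> T)"
  unfolding spans_def
proof
  fix \<phi> :: "'a \<times> 'b \<Rightarrow> 'k"
  have "\<forall>y. \<exists>c. \<forall>x\<in>S. \<phi> (x, y) = (\<Sum>i\<in>I. c i * \<xi> i x)"
    using assms(1) unfolding spans_def by (intro allI) (drule spec, assumption)
  then obtain c where c: "\<And>x y. x \<in> S \<Longrightarrow> \<phi> (x, y) = (\<Sum>i\<in>I. c y i * \<xi> i x)"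
    by metis
  have "\<forall>i. \<exists>d. \<forall>y\<in>T. c y i = (\<Sum>j\<in>J. d j * \<eta> j y)"
    using assms(2) unfolding spans_def by (intro allI) (drule spec, assumption)
  then obtain d where d: "\<And>y i. y \<in> T \<Longrightarrow> c y i = (\<Sum>j\<in>J. d i j * \<eta> j y)"
    by metis
  show "\<exists>e. \<forall>z\<in>S \<times> T. \<phi> z = (\<Sum>k\<in>I \<times> J. e k * (case k of (i, j) \<Rightarrow> \<lambda>(x, y). \<xi> i x * \<eta> j y) z)"
  proof (intro exI [where x = "\<lambda>(i, j). d i j"] ballI)
    fix z assume "z \<in> S \<times> T"
    then obtain x y where z: "z = (x, y)" "x \<in> S" "y \<in> T" by blast
    have "\<phi> z = (\<Sum>i\<in>I. \<Sum>j\<in>J. d i j * (\<xi> i x * \<eta> j y))"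
      using z by (simp add: c d sum_distrib_right sum_distrib_left mult_ac)
    also have "\<dots> = (\<Sum>k\<in>I \<times> J. (case k of (i, j) \<Rightarrow> d i j)
        * (case k of (i, j) \<Rightarrow> \<lambda>(x, y). \<xi> i x * \<eta> j y) z)"
      by (simp add: z sum.cartesian_product case_prod_unfold)
    finally show "\<phi> z = (\<Sum>k\<in>I \<times> J. (case k of (i, j) \<Rightarrow> d i j)
        * (case k of (i, j) \<Rightarrow> \<lambda>(x, y). \<xi> i x * \<eta> j y) z)" .
  qed
qed

lemma poly_mapping_eqI_spans:
  assumes "spans I \<xi> S" and "Poly_Mapping.keys f \<subseteq> S" "Poly_Mapping.keys g \<subseteq> S"
    and eq: "\<And>i. i \<in> I \<Longrightarrow> pairing f (\<xi> i) = pairing g (\<xi> i)"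
  shows "f = g"
  unfolding poly_mapping_eq_iff_pairing
proof
  fix \<phi>
  obtain c where c: "\<And>x. x \<in> S \<Longrightarrow> \<phi> x = (\<Sum>i\<in>I. c i * \<xi> i x)"
    using assms(1) unfolding spans_def by meson
  have "pairing h \<phi> = (\<Sum>i\<in>I. c i * pairing h (\<xi> i))" if "Poly_Mapping.keys h \<subseteq> S" for h
  proof -
    have "pairing h \<phi> = pairing h (\<lambda>x. \<Sum>i\<in>I. c i * \<xi> i x)"
      using c that by (intro pairing_cong) auto
    then show ?thesis by (simp add: pairing_sum_right pairing_mult_left)
  qed
  then show "pairing f \<phi> = pairing g \<phi>"
    using assms by simp
qed

locale identified_extension = coprime_extension +
  fixes \<chi> :: "'a \<Rightarrow> 'a \<Rightarrow> 'k::field_char_0"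
  assumes char_id: "char_identification G K v \<chi>"
begin

lemma chi_hom: "g \<in> K \<Longrightarrow> \<chi> g \<in> hom (subgrp G K) field_units"
  and chi_ext: "g \<in> K \<Longrightarrow> \<chi> g \<in> extensional K"
  using char_id unfolding char_identification_def iso_def hom_def character_group_def
  by (auto simp: subgrp_def)

lemma chi_mult: "\<lbrakk>g \<in> K; x \<in> K; y \<in> K\<rbrakk> \<Longrightarrow> \<chi> g (x \<otimes> y) = \<chi> g x * \<chi> g y"
  and chi_nonzero: "\<lbrakk>g \<in> K; x \<in> K\<rbrakk> \<Longrightarrow> \<chi> g x \<noteq> 0"
  using chi_hom [of g] by (auto simp: hom_def subgrp_def field_units_def)

lemma chi_mult_left: "\<lbrakk>g \<in> K; h \<in> K; x \<in> K\<rbrakk> \<Longrightarrow> \<chi> (g \<otimes> h) x = \<chi> g x * \<chi> h x"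
  using char_id unfolding char_identification_def iso_def hom_def character_group_def
  by (auto simp: subgrp_def)

lemma chi_inj: "\<lbrakk>g \<in> K; h \<in> K; \<And>x. x \<in> K \<Longrightarrow> \<chi> g x = \<chi> h x\<rbrakk> \<Longrightarrow> g = h"
proof -
  assume *: "g \<in> K" "h \<in> K" "\<And>x. x \<in> K \<Longrightarrow> \<chi> g x = \<chi> h x"
  have "inj_on \<chi> K"
    using char_id by (simp add: char_identification_def iso_def bij_betw_def subgrp_def)
  moreover have "\<chi> g = \<chi> h"
    using * chi_ext by (intro extensionalityI [where A = K]) auto
  ultimately show "g = h" using * by (simp add: inj_on_def)
qed

lemma chi_conj: "\<lbrakk>g \<in> K; x \<in> K\<rbrakk> \<Longrightarrow> \<chi> (v \<otimes> g \<otimes> inv v) x = \<chi> g (v \<otimes> x \<otimes> inv v)"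
  using char_id by (simp add: char_identification_def)

lemma chi_one_right: "g \<in> K \<Longrightarrow> \<chi> g \<one> = 1"
  using chi_mult [of g \<one> \<one>] chi_nonzero [of g \<one>] K_closed(3) by simp

lemma chi_one_left: "x \<in> K \<Longrightarrow> \<chi> \<one> x = 1"
  using chi_mult_left [of \<one> \<one> x] chi_nonzero [of \<one> x] K_closed(3) by simp

lemma sum_K_shift: "a \<in> K \<Longrightarrow> (\<Sum>x\<in>K. f (a \<otimes> x)) = (\<Sum>x\<in>K. f x)"
  by (rule sum.reindex_bij_witness [where i = "\<lambda>x. inv a \<otimes> x" and j = "\<lambda>x. a \<otimes> x"])
    (auto simp: K_closed K_carrier m_assoc [symmetric])

lemma card_K_nonzero: "(of_nat (card K) :: 'k) \<noteq> 0"
  using finite_K K_closed(3) by auto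

text \<open>For g \<noteq> \<open>\<one>\<close>, injectivity of the identification yields an a with
  \<open>\<chi> g a\<close> \<noteq> 1, and translating the sum by a multiplies it by this
  value.\<close>

lemma sum_chi_right:
  assumes "g \<in> K" shows "(\<Sum>x\<in>K. \<chi> g x) = (if g = \<one> then of_nat (card K) else 0)"
proof (cases "g = \<one>")
  case True
  then show ?thesis by (simp add: chi_one_left)
next
  case False
  then obtain a where a: "a \<in> K" "\<chi> g a \<noteq> 1"
    using chi_inj [of g \<one>] assms K_closed(3) chi_one_left by metis
  have "(\<Sum>x\<in>K. \<chi> g x) = \<chi> g a * (\<Sum>x\<in>K. \<chi> g x)"
    using sum_K_shift [OF a(1), of "\<chi> g"] assms a by (simp add: chi_mult sum_distrib_left)
  then show ?thesis using a False by simp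
qed

text \<open>Each sum \<open>\<Sum>\<^sub>g \<chi>\<^sub>g(x)\<close> is \<open>|K|\<close> or \<open>0\<close> according to whether all characters \<open>\<chi>\<^sub>g\<close> are trivial
  on \<open>x\<close>. Since these sums add up to \<open>|K|\<close>, only \<open>x = 1\<close> gives a non-zero one.\<close>

lemma sum_chi_left:
  assumes "x \<in> K" shows "(\<Sum>g\<in>K. \<chi> g x) = (if x = \<one> then of_nat (card K) else 0)"
proof -
  define X where "X = {x \<in> K. \<forall>g\<in>K. \<chi> g x = 1}"
  have T: "(\<Sum>g\<in>K. \<chi> g x) = (if x \<in> X then of_nat (card K) else 0)" if x: "x \<in> K" for x
  proof (cases "x \<in> X")
    case True
    then show ?thesis by (simp add: X_def)
  next
    case False
    then obtain a where a: "a \<in> K" "\<chi> a x \<noteq> 1"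
      using x by (auto simp: X_def)
    have "(\<Sum>g\<in>K. \<chi> g x) = \<chi> a x * (\<Sum>g\<in>K. \<chi> g x)"
      using sum_K_shift [OF a(1), of "\<lambda>g. \<chi> g x"] x a by (simp add: chi_mult_left sum_distrib_left)
    then show ?thesis using a False by simp
  qed
  have "(\<Sum>x\<in>K. \<Sum>g\<in>K. \<chi> g x) = (\<Sum>g\<in>K. if g = \<one> then of_nat (card K) else 0)"
    by (subst sum.swap) (simp add: sum_chi_right)
  also have "\<dots> = of_nat (card K)"
    using finite_K K_closed(3) by simp
  also have "(\<Sum>x\<in>K. \<Sum>g\<in>K. \<chi> g x) = (\<Sum>x\<in>K. if x \<in> X then of_nat (card K) else 0)"
    by (simp add: T)
  also have "\<dots> = (\<Sum>x\<in>X. of_nat (card K))"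
    using finite_K by (intro sum.mono_neutral_cong_right) (auto simp: X_def)
  finally have "(of_nat (card X * card K) :: 'k) = of_nat (card K)"
    by simp
  then have "card X = 1"
    using card_K_nonzero by (simp only: of_nat_eq_iff) simp
  moreover have "\<one> \<in> X"
    by (simp add: X_def K_closed chi_one_right)
  ultimately have "X = {\<one>}"
    by (auto simp: card_1_singleton_iff)
  then show ?thesis using T [OF assms] by simp
qed

lemma spans_chi: "spans K \<chi> K"
  unfolding spans_def
proof
  fix \<phi> :: "'a \<Rightarrow> 'k"
  \<comment> \<open>The Fourier coefficients of \<phi>. Evaluation at \<open>inv y\<close> takes the
    place of complex conjugation, and \<open>sum_chi_left\<close> gives the inversion
    formula.\<close>
  let ?c = "\<lambda>g. inverse (of_nat (card K)) * (\<Sum>y\<in>K. \<phi> y * \<chi> g (inv y))"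
  show "\<exists>c. \<forall>x\<in>K. \<phi> x = (\<Sum>g\<in>K. c g * \<chi> g x)"
  proof (intro exI [of _ ?c] ballI)
    fix x assume x: "x \<in> K"
    have "(\<Sum>g\<in>K. ?c g * \<chi> g x)
        = inverse (of_nat (card K)) * (\<Sum>g\<in>K. \<Sum>y\<in>K. \<phi> y * \<chi> g (inv y \<otimes> x))"
      using x by (simp add: sum_distrib_left sum_distrib_right mult_ac chi_mult K_closed)
    also have "(\<Sum>g\<in>K. \<Sum>y\<in>K. \<phi> y * \<chi> g (inv y \<otimes> x)) = (\<Sum>y\<in>K. \<phi> y * (\<Sum>g\<in>K. \<chi> g (inv y \<otimes> x)))"
      by (subst sum.swap) (simp add: sum_distrib_left)
    also have "\<dots> = (\<Sum>y\<in>K. if y = x then \<phi> x * of_nat (card K) else 0)"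
    proof (rule sum.cong)
      fix y assume y: "y \<in> K"
      then have "inv y \<otimes> x = \<one> \<longleftrightarrow> y = x"
        using x K_carrier by (metis inv_closed inv_inv inv_equality l_inv)
      then show "\<phi> y * (\<Sum>g\<in>K. \<chi> g (inv y \<otimes> x)) = (if y = x then \<phi> x * of_nat (card K) else 0)"
        using x y by (simp add: sum_chi_left K_closed)
    qed simp
    also have "\<dots> = \<phi> x * of_nat (card K)"
      using x finite_K by simp
    finally show "\<phi> x = (\<Sum>g\<in>K. ?c g * \<chi> g x)"
      using card_K_nonzero by simp
  qed
qed

lemma eq_on_characters2:
  assumes "Poly_Mapping.keys f \<subseteq> K \<times> K" "Poly_Mapping.keys g \<subseteq> K \<times> K"
    and "\<And>a b. \<lbrakk>a \<in> K; b \<in> K\<rbrakk> \<Longrightarrow>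
      pairing f (\<lambda>(x, y). \<chi> a x * \<chi> b y) = pairing g (\<lambda>(x, y). \<chi> a x * \<chi> b y)"
  shows "f = g"
  by (rule poly_mapping_eqI_spans [OF spans_prod [OF spans_chi spans_chi] assms(1,2)])
    (use assms(3) in auto)

lemma eq_on_characters3:
  assumes "Poly_Mapping.keys f \<subseteq> K \<times> K \<times> K" "Poly_Mapping.keys g \<subseteq> K \<times> K \<times> K"
    and "\<And>a b c. \<lbrakk>a \<in> K; b \<in> K; c \<in> K\<rbrakk> \<Longrightarrow>
      pairing f (\<lambda>(x, y, z). \<chi> a x * (\<chi> b y * \<chi> c z)) = pairing g (\<lambda>(x, y, z). \<chi> a x * (\<chi> b y * \<chi> c z))"
  shows "f = g"
  by (rule poly_mapping_eqI_spans
      [OF spans_prod [OF spans_chi spans_prod [OF spans_chi spans_chi]] assms(1,2)])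
    (use assms(3) in \<open>auto simp: case_prod_unfold\<close>)

lemma pairing_idem: "pairing (idem K \<chi> g) \<phi> = inverse (of_nat (card K)) * (\<Sum>x\<in>K. \<chi> g x * \<phi> x)"
  by (simp add: idem_def pairing_sum_left)

lemma pairing_R_of:
  "pairing (R_of K \<chi> w) \<phi> = (\<Sum>g\<in>K. \<Sum>h\<in>K. w g h *
     pairing (idem K \<chi> g) (\<lambda>x. pairing (idem K \<chi> h) (\<lambda>y. \<phi> (x, y))))"
  by (simp add: R_of_def pairing_sum_left pairing_tensor)

lemma keys_R_of: "Poly_Mapping.keys (R_of K \<chi> w) \<subseteq> K \<times> K"
  unfolding keys_subset_iff_pairing by (auto simp: pairing_R_of pairing_idem)

text \<open>The inverse on the right comes from the convention for \<open>idem\<close>, which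
  weights x with \<open>\<chi> g x\<close> and not with its inverse.\<close>

lemma pairing_idem_chi:
  assumes "g \<in> K" "a \<in> K"
  shows "pairing (idem K \<chi> g) (\<chi> a) = (if g = inv a then 1 else 0)"
proof -
  have "(\<Sum>x\<in>K. \<chi> g x * \<chi> a x) = (\<Sum>x\<in>K. \<chi> (g \<otimes> a) x)"
    using assms by (simp add: chi_mult_left)
  also have "\<dots> = (if g \<otimes> a = \<one> then of_nat (card K) else 0)"
    using assms by (simp add: sum_chi_right K_closed)
  also have "g \<otimes> a = \<one> \<longleftrightarrow> g = inv a"
    using assms K_carrier by (metis inv_equality l_inv)
  finally show ?thesis
    using card_K_nonzero by (simp add: pairing_idem)
qed

lemma pairing_R_of_chi:
  assumes "a \<in> K" "b \<in> K"
  shows "pairing (R_of K \<chi> w) (\<lambda>(x, y). \<chi> a x * \<chi> b y) = w (inv a) (inv b)"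
proof -
  have "pairing (R_of K \<chi> w) (\<lambda>(x, y). \<chi> a x * \<chi> b y) = (\<Sum>g\<in>K. \<Sum>h\<in>K. w g h *
     (pairing (idem K \<chi> g) (\<chi> a) * pairing (idem K \<chi> h) (\<chi> b)))"
    by (simp add: pairing_R_of pairing_mult_left pairing_mult_right)
  also have "\<dots> = (\<Sum>g\<in>K. if g = inv a then (\<Sum>h\<in>K. if h = inv b then w g h else 0) else 0)"
    using assms by (intro sum.cong) (auto simp: pairing_idem_chi intro!: sum.cong)
  also have "\<dots> = w (inv a) (inv b)"
    using assms finite_K K_closed by simp
  finally show ?thesis .
qed

lemma bicharacter_iff:
  "bicharacter G K w \<longleftrightarrow>
    (\<forall>g\<in>K. \<forall>h\<in>K. w g h \<noteq> (0::'k)) \<and>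
    (\<forall>g\<in>K. \<forall>h\<in>K. \<forall>h'\<in>K. w g (h \<otimes> h') = w g h * w g h') \<and>
    (\<forall>g\<in>K. \<forall>g'\<in>K. \<forall>h\<in>K. w (g \<otimes> g') h = w g h * w g' h)"
  by (auto simp: bicharacter_def hom_def subgrp_def field_units_def)

lemma bicharacter_one:
  assumes "bicharacter G K w" "a \<in> K"
  shows "w a \<one> = (1::'k)" "w \<one> a = 1"
  using assms K_closed(3) unfolding bicharacter_iff
  by (metis K_carrier l_one mult_cancel_left2 one_closed)+

text \<open>Both values are inverse to \<open>w a (inv b)\<close>. This absorbs the inverse labels
  in \<open>pairing_R_of_chi\<close>.\<close>

lemma bicharacter_inv_inv:
  assumes w: "bicharacter G K w" and a: "a \<in> K" and b: "b \<in> K"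
  shows "w (inv a) (inv b) = (w a b :: 'k)"
proof -
  have "w (inv a) (inv b) * w a (inv b) = 1"
    using w a b K_closed K_carrier bicharacter_one(2) [OF w, of "inv b"]
    unfolding bicharacter_iff by (metis l_inv)
  moreover have "w a b * w a (inv b) = 1"
    using w a b K_closed K_carrier bicharacter_one(1) [OF w a]
    unfolding bicharacter_iff by (metis r_inv)
  ultimately show ?thesis
    by (metis mult.commute mult_left_cancel mult_zero_left zero_neq_one)
qed

lemma pairing_R_of_bicharacter:
  assumes "bicharacter G K w" "a \<in> K" "b \<in> K"
  shows "pairing (R_of K \<chi> w) (\<lambda>(x, y). \<chi> a x * \<chi> b y) = w a b"
  using assms by (simp add: pairing_R_of_chi bicharacter_inv_inv)

end

section \<open>Quasitriangular structures and bicharacters\<close>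

context identified_extension
begin

lemma R_of_eqI:
  assumes "Poly_Mapping.keys R \<subseteq> K \<times> K" "bicharacter G K w"
    and "\<And>a b. \<lbrakk>a \<in> K; b \<in> K\<rbrakk> \<Longrightarrow> pairing R (\<lambda>(x, y). \<chi> a x * \<chi> b y) = w a b"
  shows "R = R_of K \<chi> w"
  using assms by (intro eq_on_characters2) (simp_all add: keys_R_of pairing_R_of_bicharacter)

lemma quasitriangular_imp_R_of:
  assumes QT: "quasitriangular G R"
  shows "\<exists>w. R = R_of K \<chi> w \<and> bicharacter G K w \<and>
    (\<forall>g\<in>K. \<forall>h\<in>K. w (v \<otimes> g \<otimes> inv v) (v \<otimes> h \<otimes> inv v) = w g h)"
proof -
  have keys: "Poly_Mapping.keys R \<subseteq> K \<times> K"
    using QT by (rule keys_subset_K)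
  have in_K: "x \<in> K \<and> y \<in> K" if "(x, y) \<in> Poly_Mapping.keys R" for x y
    using that keys by auto
  have unit: "R \<in> Units (group_algebra (G \<times>\<times> G))"
    and H1: "\<And>\<phi>. pairing R (\<lambda>(x, y). \<phi> x x y)
      = pairing R (\<lambda>(x, y). pairing R (\<lambda>(x', y'). \<phi> x x' (y \<otimes> y')))"
    and H2: "\<And>\<phi>. pairing R (\<lambda>(x, y). \<phi> x y y)
      = pairing R (\<lambda>(x, y). pairing R (\<lambda>(x', y'). \<phi> (x \<otimes> x') y' y))"
    and H3: "\<And>g \<phi>. g \<in> carrier G \<Longrightarrow> pairing R (\<lambda>(x, y). \<phi> (g \<otimes> x) (g \<otimes> y))
       = pairing R (\<lambda>(x, y). \<phi> (x \<otimes> g) (y \<otimes> g))"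
    using QT unfolding quasitriangular_iff_pairing [OF is_group] by blast+
  define w where "w a b = pairing R (\<lambda>(x, y). \<chi> a x * \<chi> b y)" for a b
  have w_mult1: "w (a \<otimes> a') b = w a b * w a' b" if "a \<in> K" "a' \<in> K" "b \<in> K" for a a' b
  proof -
    have "w (a \<otimes> a') b = pairing R (\<lambda>(x, y). \<chi> a x * \<chi> a' x * \<chi> b y)"
      unfolding w_def using that by (intro pairing_cong) (auto dest!: in_K simp: chi_mult_left)
    \<comment> \<open>The two factors evaluated at the same x are the two copies made by the
      comultiplication, and \<open>H1\<close> separates them.\<close>
    also have "\<dots> = pairing R (\<lambda>(x, y). pairing R (\<lambda>(x', y'). \<chi> a x * \<chi> a' x' * \<chi> b (y \<otimes> y')))"
      by (rule H1)
    also have "\<dots> = pairing R (\<lambda>(x, y). pairing R (\<lambda>(x', y'). (\<chi> a x * \<chi> b y) * (\<chi> a' x' * \<chi> b y')))"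
      using that by (intro pairing_cong) (auto intro!: pairing_cong dest!: in_K simp: chi_mult)
    also have "\<dots> = w a b * w a' b"
      by (simp add: w_def case_prod_unfold pairing_mult_left pairing_mult_right)
    finally show ?thesis .
  qed
  have w_mult2: "w a (b \<otimes> b') = w a b * w a b'" if "a \<in> K" "b \<in> K" "b' \<in> K" for a b b'
  proof -
    have "w a (b \<otimes> b') = pairing R (\<lambda>(x, y). \<chi> a x * \<chi> b y * \<chi> b' y)"
      unfolding w_def using that by (intro pairing_cong) (auto dest!: in_K simp: chi_mult_left)
    also have "\<dots> = pairing R (\<lambda>(x, y). pairing R (\<lambda>(x', y'). \<chi> a (x \<otimes> x') * \<chi> b y' * \<chi> b' y))"
      by (rule H2)
    also have "\<dots> = pairing R (\<lambda>(x, y). pairing R (\<lambda>(x', y'). (\<chi> a x * \<chi> b' y) * (\<chi> a x' * \<chi> b y')))"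
      using that by (intro pairing_cong) (auto intro!: pairing_cong dest!: in_K simp: chi_mult)
    also have "\<dots> = w a b * w a b'"
      by (simp add: w_def case_prod_unfold pairing_mult_left pairing_mult_right)
    finally show ?thesis .
  qed
  \<comment> \<open>Multiplicativity alone leaves the values 0 and 1. With \<epsilon> the counit, e
    = (\<epsilon> \<otimes> id)(R) is idempotent by \<open>H1\<close> and has a right inverse, so e
    = 1. The identities are stated for arbitrary functions on G, because the inverse of R is not
    known to be supported in K \<times> K, and \<open>\<chi> b\<close> is multiplicative only on
    K.\<close>
  have w_one: "w \<one> b = 1" if b: "b \<in> K" for b
  proof -
    obtain R' where R': "R \<otimes>\<^bsub>group_algebra (G \<times>\<times> G)\<^esub> R' = \<one>\<^bsub>group_algebra (G \<times>\<times> G)\<^esub>"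
      and keys': "Poly_Mapping.keys R' \<subseteq> carrier G \<times> carrier G"
      using unit by (auto simp: Units_def carrier_group_algebra)
    have inverse: "pairing R (\<lambda>(x, y). pairing R' (\<lambda>(x', y'). \<psi> (y \<otimes> y'))) = \<psi> \<one>" for \<psi>
      using arg_cong [OF R', of "\<lambda>f. pairing f (\<lambda>z. \<psi> (snd z))"]
      by (simp add: pairing_group_algebra_mult pairing_group_algebra_one case_prod_unfold)
    have idempotent: "pairing R (\<lambda>(x, y). \<psi> y)
        = pairing R (\<lambda>(x, y). pairing R (\<lambda>(x', y'). \<psi> (y \<otimes> y')))" for \<psi>
      by (rule H1 [of "\<lambda>_ _. \<psi>"])
    have "\<chi> b \<one> = pairing R (\<lambda>(x, y). pairing R' (\<lambda>(x', y'). \<chi> b (y \<otimes> y')))"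
      by (rule inverse [symmetric])
    also have "\<dots> = pairing R (\<lambda>(x, y). pairing R (\<lambda>(x', y'). pairing R' (\<lambda>(x'', y''). \<chi> b (y \<otimes> y' \<otimes> y''))))"
      by (rule idempotent)
    also have "\<dots> = pairing R (\<lambda>(x, y). pairing R (\<lambda>(x', y'). pairing R' (\<lambda>(x'', y''). \<chi> b (y \<otimes> (y' \<otimes> y'')))))"
      using keys' by (intro pairing_cong)
        (auto intro!: pairing_cong arg_cong [where f = "\<chi> b"] m_assoc dest!: in_K simp: K_carrier)
    also have "\<dots> = pairing R (\<lambda>(x, y). \<chi> b (y \<otimes> \<one>))"
      by (rule pairing_cong) (auto simp: inverse [of "\<lambda>z. \<chi> b (_ \<otimes> z)"])
    also have "\<dots> = w \<one> b"
      unfolding w_def using b by (intro pairing_cong) (auto dest!: in_K simp: chi_one_left K_carrier)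
    finally show ?thesis using b by (simp add: chi_one_right)
  qed
  have w_nonzero: "w a b \<noteq> 0" if "a \<in> K" "b \<in> K" for a b
    using w_mult1 [of a "inv a" b] w_one [of b] that K_closed K_carrier by auto
  have w: "bicharacter G K w"
    unfolding bicharacter_iff using w_mult1 w_mult2 w_nonzero by blast
  have "w (v \<otimes> a \<otimes> inv v) (v \<otimes> b \<otimes> inv v) = w a b" if "a \<in> K" "b \<in> K" for a b
  proof -
    have "w (v \<otimes> a \<otimes> inv v) (v \<otimes> b \<otimes> inv v)
        = pairing R (\<lambda>(x, y). \<chi> a (v \<otimes> x \<otimes> inv v) * \<chi> b (v \<otimes> y \<otimes> inv v))"
      unfolding w_def using that by (intro pairing_cong) (auto dest!: in_K simp: chi_conj)
    \<comment> \<open>Here \<open>H3\<close> is applied to the test function that first multiplies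
      both arguments by \<open>inv v\<close> on the right.\<close>
    also have "\<dots> = pairing R (\<lambda>(x, y). \<chi> a (x \<otimes> v \<otimes> inv v) * \<chi> b (y \<otimes> v \<otimes> inv v))"
      by (rule H3 [OF v])
    also have "\<dots> = w a b"
      unfolding w_def using v by (intro pairing_cong) (auto dest!: in_K simp: K_carrier m_assoc)
    finally show ?thesis .
  qed
  moreover have "R = R_of K \<chi> w"
    using keys w by (rule R_of_eqI) (simp add: w_def)
  ultimately show ?thesis using w by blast
qed

text \<open>The hexagons, invariance under v and invertibility are identities between elements
  supported in powers of K, so they may be tested on characters, where they turn into properties of
  w. Commutation with a general g = k v^i is then assembled: k commutes with the whole support, and
  v^i is reached by induction.\<close>

lemma quasitriangular_R_of:
  assumes w: "bicharacter G K w"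
    and inv_w: "\<And>g h. \<lbrakk>g \<in> K; h \<in> K\<rbrakk> \<Longrightarrow> w (v \<otimes> g \<otimes> inv v) (v \<otimes> h \<otimes> inv v) = w g h"
  shows "quasitriangular G (R_of K \<chi> w)"
proof -
  define R where "R = R_of K \<chi> w"
  have keys: "Poly_Mapping.keys R \<subseteq> K \<times> K"
    by (simp add: R_def keys_R_of)
  have in_K: "x \<in> K \<and> y \<in> K" if "(x, y) \<in> Poly_Mapping.keys R" for x y
    using that keys by auto
  have pR: "pairing R (\<lambda>(x, y). \<chi> a x * \<chi> b y) = w a b" if "a \<in> K" "b \<in> K" for a b
    unfolding R_def using w that by (rule pairing_R_of_bicharacter)
  have w_mult: "w g (h \<otimes> h') = w g h * w g h'" "w (h \<otimes> h') g = w h g * w h' g"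
    if "g \<in> K" "h \<in> K" "h' \<in> K" for g h h'
    using w that unfolding bicharacter_iff by blast+
  have H1: "pairing R (\<lambda>(x, y). \<phi> x x y)
      = pairing R (\<lambda>(x, y). pairing R (\<lambda>(x', y'). \<phi> x x' (y \<otimes> y')))" for \<phi> :: "'a \<Rightarrow> 'a \<Rightarrow> 'a \<Rightarrow> 'k"
  proof -
    \<comment> \<open>The two sides of the first hexagon. The product of legs is replaced by a
      pushforward of \<open>tensor R R\<close>, whose pairing formula involves no unit.\<close>
    let ?f = "lin_map (\<lambda>(x, y). (x, x, y)) R"
    let ?g = "lin_map (\<lambda>((x, y), (x', y')). (x, x', y \<otimes> y')) (tensor R R)"
    have pf: "pairing ?f \<psi> = pairing R (\<lambda>(x, y). \<psi> (x, x, y))" for \<psi>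
      by (simp add: pairing_lin_map case_prod_unfold)
    have pg: "pairing ?g \<psi> = pairing R (\<lambda>(x, y). pairing R (\<lambda>(x', y'). \<psi> (x, x', y \<otimes> y')))" for \<psi>
      by (simp add: pairing_lin_map pairing_tensor case_prod_unfold)
    have "?f = ?g"
    proof (rule eq_on_characters3)
      show "Poly_Mapping.keys ?f \<subseteq> K \<times> K \<times> K"
        unfolding keys_subset_iff_pairing pf
        by (auto simp: pairing_def intro!: sum.neutral dest!: in_K)
      show "Poly_Mapping.keys ?g \<subseteq> K \<times> K \<times> K"
        unfolding keys_subset_iff_pairing pg
        by (auto simp: pairing_def K_closed intro!: sum.neutral dest!: in_K)
    next
      fix a b c assume abc: "a \<in> K" "b \<in> K" "c \<in> K"
      have "pairing ?f (\<lambda>(x, y, z). \<chi> a x * (\<chi> b y * \<chi> c z)) = pairing R (\<lambda>(x, y). \<chi> (a \<otimes> b) x * \<chi> c y)"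
        unfolding pf using abc by (intro pairing_cong) (auto dest!: in_K simp: chi_mult_left)
      also have "\<dots> = w a c * w b c"
        using abc by (simp add: pR w_mult K_closed)
      also have "\<dots> = pairing R (\<lambda>(x, y). pairing R (\<lambda>(x', y'). (\<chi> a x * \<chi> c y) * (\<chi> b x' * \<chi> c y')))"
        using abc by (simp add: pR [symmetric] case_prod_unfold pairing_mult_left pairing_mult_right)
      also have "\<dots> = pairing ?g (\<lambda>(x, y, z). \<chi> a x * (\<chi> b y * \<chi> c z))"
        unfolding pg using abc
        by (intro pairing_cong) (auto intro!: pairing_cong dest!: in_K simp: chi_mult)
      finally show "pairing ?f (\<lambda>(x, y, z). \<chi> a x * (\<chi> b y * \<chi> c z))
          = pairing ?g (\<lambda>(x, y, z). \<chi> a x * (\<chi> b y * \<chi> c z))" .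
    qed
    then have "pairing ?f (\<lambda>(x, y, z). \<phi> x y z) = pairing ?g (\<lambda>(x, y, z). \<phi> x y z)"
      by (rule arg_cong)
    then show ?thesis by (simp add: pf pg)
  qed
  have H2: "pairing R (\<lambda>(x, y). \<phi> x y y)
      = pairing R (\<lambda>(x, y). pairing R (\<lambda>(x', y'). \<phi> (x \<otimes> x') y' y))" for \<phi> :: "'a \<Rightarrow> 'a \<Rightarrow> 'a \<Rightarrow> 'k"
  proof -
    let ?f = "lin_map (\<lambda>(x, y). (x, y, y)) R"
    let ?g = "lin_map (\<lambda>((x, y), (x', y')). (x \<otimes> x', y', y)) (tensor R R)"
    have pf: "pairing ?f \<psi> = pairing R (\<lambda>(x, y). \<psi> (x, y, y))" for \<psi>
      by (simp add: pairing_lin_map case_prod_unfold)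
    have pg: "pairing ?g \<psi> = pairing R (\<lambda>(x, y). pairing R (\<lambda>(x', y'). \<psi> (x \<otimes> x', y', y)))" for \<psi>
      by (simp add: pairing_lin_map pairing_tensor case_prod_unfold)
    have "?f = ?g"
    proof (rule eq_on_characters3)
      show "Poly_Mapping.keys ?f \<subseteq> K \<times> K \<times> K"
        unfolding keys_subset_iff_pairing pf
        by (auto simp: pairing_def intro!: sum.neutral dest!: in_K)
      show "Poly_Mapping.keys ?g \<subseteq> K \<times> K \<times> K"
        unfolding keys_subset_iff_pairing pg
        by (auto simp: pairing_def K_closed intro!: sum.neutral dest!: in_K)
    next
      fix a b c assume abc: "a \<in> K" "b \<in> K" "c \<in> K"
      have "pairing ?f (\<lambda>(x, y, z). \<chi> a x * (\<chi> b y * \<chi> c z)) = pairing R (\<lambda>(x, y). \<chi> a x * \<chi> (b \<otimes> c) y)"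
        unfolding pf using abc by (intro pairing_cong) (auto dest!: in_K simp: chi_mult_left)
      also have "\<dots> = w a c * w a b"
        using abc by (simp add: pR w_mult K_closed)
      also have "\<dots> = pairing R (\<lambda>(x, y). pairing R (\<lambda>(x', y'). (\<chi> a x * \<chi> c y) * (\<chi> a x' * \<chi> b y')))"
        using abc by (simp add: pR [symmetric] case_prod_unfold pairing_mult_left pairing_mult_right)
      also have "\<dots> = pairing ?g (\<lambda>(x, y, z). \<chi> a x * (\<chi> b y * \<chi> c z))"
        unfolding pg using abc
        by (intro pairing_cong) (auto intro!: pairing_cong dest!: in_K simp: chi_mult)
      finally show "pairing ?f (\<lambda>(x, y, z). \<chi> a x * (\<chi> b y * \<chi> c z))
          = pairing ?g (\<lambda>(x, y, z). \<chi> a x * (\<chi> b y * \<chi> c z))" .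
    qed
    then have "pairing ?f (\<lambda>(x, y, z). \<phi> x y z) = pairing ?g (\<lambda>(x, y, z). \<phi> x y z)"
      by (rule arg_cong)
    then show ?thesis by (simp add: pf pg)
  qed
  have inv_v: "pairing R (\<lambda>(x, y). \<phi> (v \<otimes> x \<otimes> inv v) (v \<otimes> y \<otimes> inv v)) = pairing R (\<lambda>(x, y). \<phi> x y)"
    for \<phi> :: "'a \<Rightarrow> 'a \<Rightarrow> 'k"
  proof -
    \<comment> \<open>R conjugated by v \<otimes> v. By \<open>chi_conj\<close> its transform at (a,
      b) is that of R at the conjugated pair, so \<open>inv_w\<close> amounts to equality with
      R.\<close>
    let ?f = "lin_map (\<lambda>(x, y). (v \<otimes> x \<otimes> inv v, v \<otimes> y \<otimes> inv v)) R"
    have pf: "pairing ?f \<psi> = pairing R (\<lambda>(x, y). \<psi> (v \<otimes> x \<otimes> inv v, v \<otimes> y \<otimes> inv v))" for \<psi>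
      by (simp add: pairing_lin_map case_prod_unfold)
    have "?f = R"
    proof (rule eq_on_characters2 [OF _ keys])
      show "Poly_Mapping.keys ?f \<subseteq> K \<times> K"
        unfolding keys_subset_iff_pairing pf
        by (auto simp: pairing_def K_conj intro!: sum.neutral dest!: in_K)
    next
      fix a b assume ab: "a \<in> K" "b \<in> K"
      have "pairing ?f (\<lambda>(x, y). \<chi> a x * \<chi> b y)
          = pairing R (\<lambda>(x, y). \<chi> (v \<otimes> a \<otimes> inv v) x * \<chi> (v \<otimes> b \<otimes> inv v) y)"
        unfolding pf using ab by (intro pairing_cong) (auto dest!: in_K simp: chi_conj)
      then show "pairing ?f (\<lambda>(x, y). \<chi> a x * \<chi> b y) = pairing R (\<lambda>(x, y). \<chi> a x * \<chi> b y)"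
        using ab by (simp add: pR inv_w K_conj)
    qed
    then show ?thesis
      using pf [of "case_prod \<phi>"] by simp
  qed
  have H3_v_pow: "pairing R (\<lambda>(x, y). \<phi> (v [^] i \<otimes> x) (v [^] i \<otimes> y))
      = pairing R (\<lambda>(x, y). \<phi> (x \<otimes> v [^] i) (y \<otimes> v [^] i))" for \<phi> :: "'a \<Rightarrow> 'a \<Rightarrow> 'k" and i :: nat
  proof (induction i arbitrary: \<phi>)
    case 0
    show ?case by (rule pairing_cong) (auto dest!: in_K simp: K_carrier)
  next
    case (Suc i)
    have "pairing R (\<lambda>(x, y). \<phi> (v [^] Suc i \<otimes> x) (v [^] Suc i \<otimes> y))
        = pairing R (\<lambda>(x, y). \<phi> (v [^] i \<otimes> (v \<otimes> x \<otimes> inv v \<otimes> v)) (v [^] i \<otimes> (v \<otimes> y \<otimes> inv v \<otimes> v)))"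
      using v by (intro pairing_cong) (auto dest!: in_K simp: K_carrier m_assoc)
    also have "\<dots> = pairing R (\<lambda>(x, y). \<phi> (v [^] i \<otimes> (x \<otimes> v)) (v [^] i \<otimes> (y \<otimes> v)))"
      by (rule inv_v [of "\<lambda>x y. \<phi> (v [^] i \<otimes> (x \<otimes> v)) (v [^] i \<otimes> (y \<otimes> v))"])
    also have "\<dots> = pairing R (\<lambda>(x, y). \<phi> (v [^] i \<otimes> x \<otimes> v) (v [^] i \<otimes> y \<otimes> v))"
      using v by (intro pairing_cong) (auto dest!: in_K simp: K_carrier m_assoc)
    also have "\<dots> = pairing R (\<lambda>(x, y). \<phi> (x \<otimes> v [^] i \<otimes> v) (y \<otimes> v [^] i \<otimes> v))"
      by (rule Suc [of "\<lambda>x y. \<phi> (x \<otimes> v) (y \<otimes> v)"])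
    also have "\<dots> = pairing R (\<lambda>(x, y). \<phi> (x \<otimes> v [^] Suc i) (y \<otimes> v [^] Suc i))"
      using v by (intro pairing_cong) (auto dest!: in_K simp: K_carrier m_assoc)
    finally show ?case .
  qed
  have H3: "pairing R (\<lambda>(x, y). \<phi> (g \<otimes> x) (g \<otimes> y)) = pairing R (\<lambda>(x, y). \<phi> (x \<otimes> g) (y \<otimes> g))"
    if g: "g \<in> carrier G" for g and \<phi> :: "'a \<Rightarrow> 'a \<Rightarrow> 'k"
  proof -
    obtain k i where k: "k \<in> K" "g = k \<otimes> v [^] (i::nat)"
      using decomp g by blast
    have kG: "k \<in> carrier G" using k(1) by (rule K_carrier)
    have "pairing R (\<lambda>(x, y). \<phi> (g \<otimes> x) (g \<otimes> y))
        = pairing R (\<lambda>(x, y). \<phi> (k \<otimes> (v [^] i \<otimes> x)) (k \<otimes> (v [^] i \<otimes> y)))"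
      using k v kG by (intro pairing_cong) (auto dest!: in_K simp: K_carrier m_assoc)
    also have "\<dots> = pairing R (\<lambda>(x, y). \<phi> (k \<otimes> (x \<otimes> v [^] i)) (k \<otimes> (y \<otimes> v [^] i)))"
      by (rule H3_v_pow [of "\<lambda>x y. \<phi> (k \<otimes> x) (k \<otimes> y)"])
    also have "\<dots> = pairing R (\<lambda>(x, y). \<phi> (x \<otimes> g) (y \<otimes> g))"
    proof (rule pairing_cong)
      have *: "k \<otimes> (x \<otimes> v [^] i) = x \<otimes> g" if "x \<in> K" for x
        using K_comm [OF k(1) that] K_carrier [OF that] k(2) kG v by (metis m_assoc nat_pow_closed)
      fix z assume "z \<in> Poly_Mapping.keys R"
      then show "(case z of (x, y) \<Rightarrow> \<phi> (k \<otimes> (x \<otimes> v [^] i)) (k \<otimes> (y \<otimes> v [^] i)))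
          = (case z of (x, y) \<Rightarrow> \<phi> (x \<otimes> g) (y \<otimes> g))"
        by (cases z) (auto dest!: in_K simp: *)
    qed
    finally show ?thesis .
  qed
  have unit: "R \<in> Units (group_algebra (G \<times>\<times> G))"
  proof -
    \<comment> \<open>Characters of K \<times> K are multiplicative, so the transform turns products
      into pointwise products. The inverse of R is therefore sought with transform 1/w, again a
      bicharacter.\<close>
    define w' where "w' a b = inverse (w a b)" for a b
    have w': "bicharacter G K w'"
      using w unfolding bicharacter_iff w'_def by simp
    define R' where "R' = R_of K \<chi> w'"
    have keys': "Poly_Mapping.keys R' \<subseteq> K \<times> K"
      by (simp add: R'_def keys_R_of)
    have pR': "pairing R' (\<lambda>(x, y). \<chi> a x * \<chi> b y) = w' a b" if "a \<in> K" "b \<in> K" for a b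
      unfolding R'_def using w' that by (rule pairing_R_of_bicharacter)
    have one: "S \<otimes>\<^bsub>group_algebra (G \<times>\<times> G)\<^esub> T = \<one>\<^bsub>group_algebra (G \<times>\<times> G)\<^esub>"
      if S: "Poly_Mapping.keys S \<subseteq> K \<times> K" and T: "Poly_Mapping.keys T \<subseteq> K \<times> K"
        and *: "\<And>a b. \<lbrakk>a \<in> K; b \<in> K\<rbrakk> \<Longrightarrow> pairing S (\<lambda>(x, y). \<chi> a x * \<chi> b y)
          * pairing T (\<lambda>(x, y). \<chi> a x * \<chi> b y) = 1" for S T
    proof (rule eq_on_characters2)
      have "a \<in> K \<and> b \<in> K" if "(a, b) \<in> Poly_Mapping.keys S" for a b
        using that S by auto
      moreover have "a \<in> K \<and> b \<in> K" if "(a, b) \<in> Poly_Mapping.keys T" for a b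
        using that T by auto
      ultimately show "Poly_Mapping.keys (S \<otimes>\<^bsub>group_algebra (G \<times>\<times> G)\<^esub> T) \<subseteq> K \<times> K"
        unfolding keys_subset_iff_pairing pairing_group_algebra_mult
        by (fastforce simp: pairing_def K_closed intro!: sum.neutral)
      show "Poly_Mapping.keys (\<one>\<^bsub>group_algebra (G \<times>\<times> G)\<^esub> :: 'a \<times> 'a \<Rightarrow>\<^sub>0 'k) \<subseteq> K \<times> K"
        unfolding keys_subset_iff_pairing pairing_group_algebra_one by (simp add: K_closed)
    next
      fix a b assume ab: "a \<in> K" "b \<in> K"
      have "pairing (S \<otimes>\<^bsub>group_algebra (G \<times>\<times> G)\<^esub> T) (\<lambda>(x, y). \<chi> a x * \<chi> b y)
          = pairing S (\<lambda>(x, y). pairing T (\<lambda>(x', y'). (\<chi> a x * \<chi> b y) * (\<chi> a x' * \<chi> b y')))"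
        unfolding pairing_group_algebra_mult case_prod_unfold using S T ab
        by (intro pairing_cong) (force simp: chi_mult)
      also have "\<dots> = 1"
        using * [OF ab] by (simp add: case_prod_unfold pairing_mult_left pairing_mult_right)
      also have "\<dots> = pairing \<one>\<^bsub>group_algebra (G \<times>\<times> G)\<^esub> (\<lambda>(x, y). \<chi> a x * \<chi> b y)"
        using ab by (simp add: pairing_group_algebra_one chi_one_right)
      finally show "pairing (S \<otimes>\<^bsub>group_algebra (G \<times>\<times> G)\<^esub> T) (\<lambda>(x, y). \<chi> a x * \<chi> b y)
          = pairing \<one>\<^bsub>group_algebra (G \<times>\<times> G)\<^esub> (\<lambda>(x, y). \<chi> a x * \<chi> b y)" .
    qed
    have ww': "w a b * w' a b = 1" "w' a b * w a b = 1" if "a \<in> K" "b \<in> K" for a b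
      using w that unfolding bicharacter_iff w'_def by simp_all
    have "K \<times> K \<subseteq> carrier (G \<times>\<times> G)"
      using K_carrier by auto
    then have "R \<in> carrier (group_algebra (G \<times>\<times> G))" "R' \<in> carrier (group_algebra (G \<times>\<times> G))"
      using keys keys' unfolding carrier_group_algebra by blast+
    moreover have "R \<otimes>\<^bsub>group_algebra (G \<times>\<times> G)\<^esub> R' = \<one>\<^bsub>group_algebra (G \<times>\<times> G)\<^esub>"
      by (rule one [OF keys keys']) (simp add: pR pR' ww')
    moreover have "R' \<otimes>\<^bsub>group_algebra (G \<times>\<times> G)\<^esub> R = \<one>\<^bsub>group_algebra (G \<times>\<times> G)\<^esub>"
      by (rule one [OF keys' keys]) (simp add: pR pR' ww')
    ultimately show ?thesis unfolding Units_def by blast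
  qed
  show ?thesis
    unfolding R_def [symmetric] quasitriangular_iff_pairing [OF is_group]
    using unit H1 H2 H3 by blast
qed

lemma quasitriangular_eq:
  "{R. quasitriangular G R} = {R_of K \<chi> w |w. bicharacter G K w \<and>
    (\<forall>g\<in>K. \<forall>h\<in>K. w (v \<otimes> g \<otimes> inv v) (v \<otimes> h \<otimes> inv v) = w g h)}"
  using quasitriangular_imp_R_of quasitriangular_R_of by blast

end

section \<open>Normal subgroups generated by two commuting elements\<close>

lemma (in group) generate_two_commuting:
  assumes s: "s \<in> carrier G" and t: "t \<in> carrier G" and st: "s \<otimes> t = t \<otimes> s"
    and a: "s [^] a = \<one>" "a > (0::nat)" and b: "t [^] b = \<one>" "b > (0::nat)"
  shows "generate G {s, t} \<subseteq> (\<lambda>(i, j). s [^] i \<otimes> t [^] j) ` ({..<a} \<times> {..<b})"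
proof
  \<comment> \<open>A finite exponent makes inverses natural powers, so the products of natural
    powers are already closed under inversion.\<close>
  have inv_pow: "inv x = x [^] (n - 1)" if "x \<in> carrier G" "x [^] n = \<one>" "n > 0" for x and n :: nat
  proof (rule inv_equality)
    show "x [^] (n - 1) \<otimes> x = \<one>"
      using that by (metis Suc_diff_1 nat_pow_Suc)
  qed (use that in simp_all)
  have ts_pow: "t [^] j \<otimes> s [^] i = s [^] i \<otimes> t [^] j" for i j :: nat
    using s t st by (metis group_commutes_pow nat_pow_closed)
  fix x assume "x \<in> generate G {s, t}"
  then have "\<exists>(i::nat) (j::nat). x = s [^] i \<otimes> t [^] j"
  proof induction
    case one
    show ?case by (rule exI [of _ 0], rule exI [of _ 0]) simp
  next
    case (incl h)
    have "s = s [^] (1::nat) \<otimes> t [^] (0::nat)" "t = s [^] (0::nat) \<otimes> t [^] (1::nat)"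
      using s t by simp_all
    then show ?case using incl by blast
  next
    case (inv h)
    have "inv s = s [^] (a - 1) \<otimes> t [^] (0::nat)" "inv t = s [^] (0::nat) \<otimes> t [^] (b - 1)"
      using s t by (simp_all add: inv_pow [OF s a] inv_pow [OF t b])
    then show ?case using inv by blast
  next
    case (eng h1 h2)
    then obtain i j k l :: nat where h: "h1 = s [^] i \<otimes> t [^] j" "h2 = s [^] k \<otimes> t [^] l"
      by blast
    have "h1 \<otimes> h2 = s [^] i \<otimes> (t [^] j \<otimes> s [^] k) \<otimes> t [^] l"
      using s t by (simp add: h m_assoc)
    also have "\<dots> = (s [^] i \<otimes> s [^] k) \<otimes> (t [^] j \<otimes> t [^] l)"
      unfolding ts_pow using s t by (simp add: m_assoc)
    also have "\<dots> = s [^] (i + k) \<otimes> t [^] (j + l)"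
      using s t by (simp add: nat_pow_mult)
    finally show ?case by blast
  qed
  then obtain i j :: nat where x: "x = s [^] i \<otimes> t [^] j" by blast
  have "s [^] i = s [^] (i mod a)" "t [^] j = t [^] (j mod b)"
    using s t a b by (auto intro!: pow_cong simp: cong_def)
  then show "x \<in> (\<lambda>(i, j). s [^] i \<otimes> t [^] j) ` ({..<a} \<times> {..<b})"
    using x a b by (intro image_eqI [where x = "(i mod a, j mod b)"]) auto
qed

lemma (in group) conj_mult:
  "\<lbrakk>v \<in> carrier G; x \<in> carrier G; y \<in> carrier G\<rbrakk> \<Longrightarrow>
    v \<otimes> (x \<otimes> y) \<otimes> inv v = (v \<otimes> x \<otimes> inv v) \<otimes> (v \<otimes> y \<otimes> inv v)"
proof -
  assume *: "v \<in> carrier G" "x \<in> carrier G" "y \<in> carrier G"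
  then have "inv v \<otimes> (v \<otimes> (y \<otimes> inv v)) = y \<otimes> inv v"
    by (simp add: m_assoc [symmetric])
  with * show ?thesis by (simp add: m_assoc)
qed

lemma (in group) conj_generate:
  assumes X: "X \<subseteq> carrier G" and v: "v \<in> carrier G"
    and conj: "\<And>x. x \<in> X \<Longrightarrow> v \<otimes> x \<otimes> inv v \<in> generate G X"
    and x: "x \<in> generate G X"
  shows "v \<otimes> x \<otimes> inv v \<in> generate G X"
  using x
proof induction
  case one
  show ?case using v by (simp add: generate.one)
next
  case (incl h)
  then show ?case by (rule conj)
next
  case (inv h)
  then have "v \<otimes> inv h \<otimes> inv v = inv (v \<otimes> h \<otimes> inv v)"
    using X v by (auto simp: inv_mult_group m_assoc)
  then show ?case using generate_m_inv_closed [OF X conj] inv by simp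
next
  case (eng h1 h2)
  then show ?case
    using conj_mult [OF v] generate_in_carrier [OF X] by (simp add: generate.eng)
qed

text \<open>Every condition on K is reduced to the generators. The choice t = s is allowed and gives
  the cyclic K of case (1).\<close>

lemma (in group) coprime_extension_two_generators:
  assumes p: "prime p" and coprime: "coprime p N" and N: "N > 0"
    and s: "s \<in> carrier G" and t: "t \<in> carrier G" and v: "v \<in> carrier G"
    and st: "s \<otimes> t = t \<otimes> s" and s_pow: "s [^] (N::nat) = \<one>" and t_pow: "t [^] N = \<one>"
    and v_pow: "v [^] (p::nat) = \<one>"
    and conj: "v \<otimes> s \<otimes> inv v \<in> generate G {s, t}" "v \<otimes> t \<otimes> inv v \<in> generate G {s, t}"
    and noncentral: "v \<otimes> s \<otimes> inv v \<noteq> s \<or> v \<otimes> t \<otimes> inv v \<noteq> t"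
    and generated: "carrier G \<subseteq> generate G {s, t, v}"
  shows "coprime_extension G (generate G {s, t}) v p N"
proof (intro coprime_extension.intro coprime_extension_axioms.intro)
  let ?K = "generate G {s, t}"
  have X: "{s, t} \<subseteq> carrier G" using s t by simp
  have K_eq: "?K \<subseteq> (\<lambda>(i, j). s [^] i \<otimes> t [^] j) ` ({..<N} \<times> {..<N})"
    by (rule generate_two_commuting [OF s t st s_pow N t_pow N])
  have ts_pow: "t [^] j \<otimes> s [^] i = s [^] i \<otimes> t [^] j" for i j :: nat
    using s t st by (metis group_commutes_pow nat_pow_closed)
  have K_form: "\<exists>(i::nat) (j::nat). x = s [^] i \<otimes> t [^] j" if "x \<in> ?K" for x
    using subsetD [OF K_eq that] by auto
  show "group G" by (rule is_group)
  show "subgroup ?K G" using X by (rule generate_is_subgroup)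
  show "finite ?K" using K_eq by (rule finite_subset) simp
  show "x \<otimes> y = y \<otimes> x" if x: "x \<in> ?K" and y: "y \<in> ?K" for x y
  proof -
    obtain i j k l where xy: "x = s [^] (i::nat) \<otimes> t [^] (j::nat)" "y = s [^] (k::nat) \<otimes> t [^] (l::nat)"
      using K_form [OF x] K_form [OF y] by blast
    have mult: "s [^] a \<otimes> t [^] b \<otimes> (s [^] c \<otimes> t [^] d) = s [^] (a + c) \<otimes> t [^] (b + d)"
      for a b c d :: nat
    proof -
      have "s [^] a \<otimes> t [^] b \<otimes> (s [^] c \<otimes> t [^] d) = s [^] a \<otimes> (t [^] b \<otimes> s [^] c) \<otimes> t [^] d"
        using s t by (simp add: m_assoc)
      also have "\<dots> = (s [^] a \<otimes> s [^] c) \<otimes> (t [^] b \<otimes> t [^] d)"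
        unfolding ts_pow using s t by (simp add: m_assoc)
      finally show ?thesis using s t by (simp add: nat_pow_mult)
    qed
    show ?thesis by (simp add: xy mult add.commute)
  qed
  show "x [^] N = \<one>" if x: "x \<in> ?K" for x
  proof -
    obtain i j where xij: "x = s [^] (i::nat) \<otimes> t [^] (j::nat)"
      using K_form [OF x] by blast
    have "x [^] N = (s [^] i) [^] N \<otimes> (t [^] j) [^] N"
      unfolding xij using s t ts_pow by (intro pow_mult_distrib) auto
    also have "\<dots> = \<one>"
      using s t s_pow t_pow by (metis l_one mult.commute nat_pow_one nat_pow_pow one_closed)
    finally show ?thesis .
  qed
  show "v \<otimes> x \<otimes> inv v \<in> ?K" if "x \<in> ?K" for x
    using X v _ that by (rule conj_generate) (use conj in auto)
  show "carrier G \<subseteq> generate G (insert v ?K)"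
  proof -
    have "{s, t, v} \<subseteq> insert v ?K" by (auto intro: generate.incl)
    then show ?thesis using generated mono_generate by (metis subset_trans)
  qed
  show "\<exists>k\<in>?K. v \<otimes> k \<noteq> k \<otimes> v"
  proof (rule ccontr)
    assume "\<not> ?thesis"
    then have "v \<otimes> s = s \<otimes> v" "v \<otimes> t = t \<otimes> v"
      by (auto intro: generate.incl)
    then show False
      using noncentral s t v by (simp add: m_assoc)
  qed
qed (fact v v_pow p coprime)+

lemma (in group) hom_field_units_eqI:
  assumes X: "X \<subseteq> carrier G"
    and f: "f \<in> hom (subgrp G (generate G X)) field_units"
    and f': "f' \<in> hom (subgrp G (generate G X)) field_units"
    and eq: "\<And>x. x \<in> X \<Longrightarrow> f x = f' x" and x: "x \<in> generate G X"
  shows "f x = (f' x :: 'k::field)"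
proof -
  have mult: "h (a \<otimes> b) = h a * h b" "h a \<noteq> 0"
    if "h \<in> hom (subgrp G (generate G X)) (field_units :: 'k monoid)" "a \<in> generate G X" "b \<in> generate G X"
    for h a b
    using that by (auto simp: hom_def subgrp_def field_units_def)
  have hom_one: "h \<one> = 1" if h: "h \<in> hom (subgrp G (generate G X)) (field_units :: 'k monoid)" for h
    using mult [OF h generate.one generate.one] by simp
  show ?thesis
    using x
  proof induction
    case one
    show ?case by (simp add: hom_one [OF f] hom_one [OF f'])
  next
    case (incl h)
    then show ?case by (rule eq)
  next
    case (inv h)
    have h: "h \<in> generate G X" "inv h \<in> generate G X" "h \<in> carrier G"
      using inv X by (auto intro: generate.intros)
    have "f h * f (inv h) = f' h * f' (inv h)"
      using h by (simp add: mult(1) [OF f, symmetric] mult(1) [OF f', symmetric] hom_one [OF f] hom_one [OF f'])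
    then show ?case
      using eq [OF inv] mult(2) [OF f' h(1) h(1)] by simp
  next
    case (eng h1 h2)
    then show ?case by (simp add: mult(1) [OF f] mult(1) [OF f'])
  qed
qed

text \<open>With a generator fixed in the second variable, extend in the first; then fix any element
  in the first variable and extend in the second.\<close>

lemma (in group) bicharacter_eqI:
  fixes w w' :: "'a \<Rightarrow> 'a \<Rightarrow> 'k::field"
  assumes X: "X \<subseteq> carrier G"
    and w: "bicharacter G (generate G X) w" and w': "bicharacter G (generate G X) w'"
    and eq: "\<And>x y. \<lbrakk>x \<in> X; y \<in> X\<rbrakk> \<Longrightarrow> w x y = w' x y"
    and xy: "x \<in> generate G X" "y \<in> generate G X"
  shows "w x y = w' x y"
proof -
  have 1: "w a b = w' a b" if "a \<in> generate G X" "b \<in> X" for a b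
    using that w w' unfolding bicharacter_def
    by (intro hom_field_units_eqI [OF X _ _ _ that(1), of "\<lambda>a. w a b" "\<lambda>a. w' a b"])
      (auto intro: eq generate.incl)
  show ?thesis
    using xy w w' unfolding bicharacter_def
    by (intro hom_field_units_eqI [OF X _ _ _ xy(2), of "w x" "w' x"]) (auto intro: 1)
qed

text \<open>Invariance of w under v thus becomes an equality of two bicharacters, which need only be
  compared on pairs of generators. This is the origin of the finite lists of conditions on
  w.\<close>

lemma (in identified_extension) bicharacter_conj:
  assumes "bicharacter G K (w :: 'a \<Rightarrow> 'a \<Rightarrow> 'k)"
  shows "bicharacter G K (\<lambda>g h. w (v \<otimes> g \<otimes> inv v) (v \<otimes> h \<otimes> inv v))"
  using assms unfolding bicharacter_iff
  by (simp add: conj_mult [OF v] K_carrier K_conj)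

lemma (in group) quasitriangular_two_generators:
  fixes \<chi> :: "'a \<Rightarrow> 'a \<Rightarrow> 'k::field_char_0"
  assumes ext: "coprime_extension G (generate G {s, t}) v p N"
    and st: "s \<in> carrier G" "t \<in> carrier G"
    and s': "v \<otimes> s \<otimes> inv v = s'" and t': "v \<otimes> t \<otimes> inv v = t'"
    and \<chi>: "char_identification G (generate G {s, t}) v \<chi>"
  shows "{R. quasitriangular G R} =
    {R_of (generate G {s, t}) \<chi> w |w. bicharacter G (generate G {s, t}) w \<and>
      w s' s' = w s s \<and> w s' t' = w s t \<and> w t' s' = w t s \<and> w t' t' = w t t}"
proof -
  let ?K = "generate G {s, t}"
  interpret identified_extension G ?K v p N \<chi>
    using ext \<chi> by (intro identified_extension.intro identified_extension_axioms.intro)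
  have "(\<forall>g\<in>?K. \<forall>h\<in>?K. w (v \<otimes> g \<otimes> inv v) (v \<otimes> h \<otimes> inv v) = w g h) \<longleftrightarrow>
      w s' s' = w s s \<and> w s' t' = w s t \<and> w t' s' = w t s \<and> w t' t' = w t t"
    if w: "bicharacter G ?K w" for w :: "'a \<Rightarrow> 'a \<Rightarrow> 'k"
  proof
    assume "\<forall>g\<in>?K. \<forall>h\<in>?K. w (v \<otimes> g \<otimes> inv v) (v \<otimes> h \<otimes> inv v) = w g h"
    moreover have "s \<in> ?K" "t \<in> ?K" by (auto intro: generate.incl)
    ultimately show "w s' s' = w s s \<and> w s' t' = w s t \<and> w t' s' = w t s \<and> w t' t' = w t t"
      unfolding s' [symmetric] t' [symmetric] by blast
  next
    assume *: "w s' s' = w s s \<and> w s' t' = w s t \<and> w t' s' = w t s \<and> w t' t' = w t t"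
    have eq: "w (v \<otimes> x \<otimes> inv v) (v \<otimes> y \<otimes> inv v) = w x y" if "x \<in> {s, t}" "y \<in> {s, t}" for x y
      using that * s' t' by auto
    have "{s, t} \<subseteq> carrier G" using st by simp
    then show "\<forall>g\<in>?K. \<forall>h\<in>?K. w (v \<otimes> g \<otimes> inv v) (v \<otimes> h \<otimes> inv v) = w g h"
      by (intro ballI) (rule bicharacter_eqI [OF _ bicharacter_conj [OF w] w eq])
  qed
  then show ?thesis
    unfolding quasitriangular_eq by blast
qed

section \<open>Presented groups\<close>

lemma word_class_eq_iff: "word_class Rel u = word_class Rel v \<longleftrightarrow> word_cong Rel u v"
  unfolding word_class_def using wc_refl wc_sym wc_trans by (metis (mono_tags) Collect_cong mem_Collect_eq)

lemma word_cong_append: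
  assumes "word_cong Rel u u'" "word_cong Rel v v'" shows "word_cong Rel (u @ v) (u' @ v')"
  using wc_context [OF assms(1), of "[]" v] wc_context [OF assms(2), of u' "[]"]
  by (auto intro: wc_trans)

lemma presented_group_mult [simp]:
  "word_class Rel u \<otimes>\<^bsub>presented_group Rel\<^esub> word_class Rel v = word_class Rel (u @ v)"
proof -
  have *: "word_class Rel (a @ b) = word_class Rel (u @ v)"
    if "a \<in> word_class Rel u" "b \<in> word_class Rel v" for a b
    using that unfolding word_class_eq_iff
    by (auto simp: word_class_def intro: wc_sym word_cong_append)
  have "u \<in> word_class Rel u" "v \<in> word_class Rel v"
    by (simp_all add: word_class_def wc_refl)
  then have "(\<Union>a\<in>word_class Rel u. \<Union>b\<in>word_class Rel v. word_class Rel (u @ v)) = word_class Rel (u @ v)"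
    by blast
  moreover have "(\<Union>a\<in>word_class Rel u. \<Union>b\<in>word_class Rel v. word_class Rel (a @ b))
      = (\<Union>a\<in>word_class Rel u. \<Union>b\<in>word_class Rel v. word_class Rel (u @ v))"
    by (intro SUP_cong refl *)
  ultimately show ?thesis
    by (simp add: presented_group_def)
qed

lemma presented_group_one: "\<one>\<^bsub>presented_group Rel\<^esub> = word_class Rel []"
  by (simp add: presented_group_def)

lemma carrier_presented_group: "carrier (presented_group Rel) = range (word_class Rel)"
  by (simp add: presented_group_def)

lemma word_class_in_carrier [simp]: "word_class Rel u \<in> carrier (presented_group Rel)"
  by (simp add: carrier_presented_group)

lemma word_cong_winv: "word_cong Rel (winv u @ u) []"
proof (induction u)
  case Nil
  show ?case by (simp add: winv_def wc_refl)
next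
  case (Cons y u)
  obtain x b where y: "y = (x, b)" by (cases y)
  \<comment> \<open>The innermost pair is written with a double negation, so that it is literally an
    instance of \<open>wc_cancel\<close>.\<close>
  have "winv (y # u) @ y # u = winv u @ [(x, \<not> b), (x, \<not> \<not> b)] @ u"
    by (simp add: winv_def y)
  moreover have "word_cong Rel (winv u @ [(x, \<not> b), (x, \<not> \<not> b)] @ u) (winv u @ [] @ u)"
    by (intro wc_context wc_cancel)
  ultimately show ?case
    using Cons wc_trans by fastforce
qed

lemma group_presented_group: "group (presented_group Rel)"
proof (rule groupI)
  fix x assume "x \<in> carrier (presented_group Rel)"
  then obtain u where "x = word_class Rel u" by (auto simp: carrier_presented_group)
  then have "word_class Rel (winv u) \<otimes>\<^bsub>presented_group Rel\<^esub> x = \<one>\<^bsub>presented_group Rel\<^esub>"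
    by (simp add: presented_group_one word_class_eq_iff word_cong_winv)
  then show "\<exists>y\<in>carrier (presented_group Rel). y \<otimes>\<^bsub>presented_group Rel\<^esub> x = \<one>\<^bsub>presented_group Rel\<^esub>"
    by (rule bexI [OF _ word_class_in_carrier])
qed (auto simp: carrier_presented_group presented_group_one)

lemma generator_in_carrier [simp]: "generator Rel x \<in> carrier (presented_group Rel)"
  by (simp add: generator_def)

lemma word_class_append:
  "word_class Rel (u @ v) = word_class Rel u \<otimes>\<^bsub>presented_group Rel\<^esub> word_class Rel v"
  by simp

lemma word_class_winv: "word_class Rel (winv u) = inv\<^bsub>presented_group Rel\<^esub> (word_class Rel u)"
  by (rule group.inv_equality [OF group_presented_group, symmetric])
    (simp_all add: presented_group_one word_class_eq_iff word_cong_winv)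

lemma word_class_wpow:
  "word_class Rel (wpow x n) = generator Rel x [^]\<^bsub>presented_group Rel\<^esub> n"
proof -
  interpret group "presented_group Rel" by (rule group_presented_group)
  show ?thesis
  proof (induction n)
    case 0
    show ?case by (simp add: wpow_def presented_group_one)
  next
    case (Suc n)
    have "wpow x (Suc n) = wpow x n @ [(x, True)]"
      by (simp add: wpow_def replicate_append_same)
    then have "word_class Rel (wpow x (Suc n))
        = word_class Rel (wpow x n) \<otimes>\<^bsub>presented_group Rel\<^esub> generator Rel x"
      by (simp add: generator_def)
    then show ?case by (simp add: Suc)
  qed
qed

lemma word_class_wpow_1: "word_class Rel (wpow x 1) = generator Rel x"
  by (simp add: wpow_def generator_def)

lemma word_class_wconj:
  "word_class Rel (wconj v u) = word_class Rel v \<otimes>\<^bsub>presented_group Rel\<^esub> word_class Rel u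
     \<otimes>\<^bsub>presented_group Rel\<^esub> inv\<^bsub>presented_group Rel\<^esub> (word_class Rel v)"
  by (simp add: wconj_def word_class_winv [symmetric])

lemma presented_group_relation:
  "(l, r) \<in> Rel \<Longrightarrow> word_class Rel l = word_class Rel r"
  by (simp add: word_class_eq_iff wc_rel)

lemma presented_group_generated:
  "carrier (presented_group Rel) \<subseteq> generate (presented_group Rel) (range (generator Rel))"
proof -
  interpret group "presented_group Rel" by (rule group_presented_group)
  have "word_class Rel u \<in> generate (presented_group Rel) (range (generator Rel))" for u
  proof (induction u)
    case Nil
    show ?case by (metis generate.one presented_group_one)
  next
    case (Cons y u)
    obtain x b where y: "y = (x, b)" by (cases y)
    have "word_class Rel [y] \<in> generate (presented_group Rel) (range (generator Rel))"
    proof (cases b)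
      case True
      then show ?thesis
        by (auto simp: y generator_def [symmetric] intro: generate.incl)
    next
      case False
      have "[(x, False)] = winv [(x, True)]" by (simp add: winv_def)
      then have "word_class Rel [y] = inv\<^bsub>presented_group Rel\<^esub> (generator Rel x)"
        using False by (simp add: y word_class_winv generator_def)
      then show ?thesis by (auto intro: generate.inv)
    qed
    then show ?case
      using Cons generate.eng word_class_append [of Rel "[y]" u] by fastforce
  qed
  then show ?thesis by (auto simp: carrier_presented_group)
qed

text \<open>Words act by affine maps modulo \<open>N\<close>, where \<open>a' x\<close> stands for the inverse of \<open>a x\<close>.
  Such actions separate \<open>s\<^sup>m\<close> from \<open>s\<close> in the presented groups.\<close>

fun affine_action :: "('x \<Rightarrow> int) \<Rightarrow> ('x \<Rightarrow> int) \<Rightarrow> ('x \<Rightarrow> int) \<Rightarrow> 'x word \<Rightarrow> int \<Rightarrow> int" where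
  "affine_action a a' b [] z = z"
| "affine_action a a' b ((x, True) # u) z = a x * affine_action a a' b u z + b x"
| "affine_action a a' b ((x, False) # u) z = a' x * (affine_action a a' b u z - b x)"

lemma affine_action_append:
  "affine_action a a' b (u @ v) z = affine_action a a' b u (affine_action a a' b v z)"
  by (induction a a' b u z rule: affine_action.induct) auto

lemma affine_action_cong:
  "[z = z'] (mod N) \<Longrightarrow> [affine_action a a' b u z = affine_action a a' b u z'] (mod N)"
  by (induction a a' b u z rule: affine_action.induct)
    (auto intro!: cong_add cong_mult cong_diff)

lemma affine_action_wpow:
  "a x = 1 \<Longrightarrow> affine_action a a' b (wpow x n) z = z + int n * b x"
  "b x = 0 \<Longrightarrow> affine_action a a' b (wpow x n) z = a x ^ n * z"
  by (induction n) (simp_all add: wpow_def algebra_simps)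

text \<open>The action descends to the presented group as soon as it respects the relations. The
  point z varies in the induction, because a context evaluates the inner words at another
  point.\<close>

lemma word_cong_affine_action:
  assumes a: "\<And>x. [a x * a' x = 1] (mod N)"
    and Rel: "\<And>l r z. (l, r) \<in> Rel \<Longrightarrow> [affine_action a a' b l z = affine_action a a' b r z] (mod N)"
  shows "word_cong Rel u v \<Longrightarrow> [affine_action a a' b u z = affine_action a a' b v z] (mod N)"
proof (induction arbitrary: z rule: word_cong.induct)
  case (wc_cancel x c)
  have *: "[a x * a' x * y = y] (mod N)" for y
    using cong_scalar_right [OF a, of x y] by simp
  show ?case
  proof (cases c)
    case True
    have "[a x * a' x * (z - b x) + b x = (z - b x) + b x] (mod N)"
      by (intro cong_add * cong_refl)
    with True show ?thesis by (simp add: mult.assoc)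
  next
    case False
    then show ?thesis using * [of z] by (simp add: mult_ac)
  qed
next
  case (wc_context u v l r)
  then show ?case by (simp add: affine_action_append affine_action_cong)
qed (auto simp: Rel cong_sym intro: cong_trans)

text \<open>Conjugating a translation by an affine map scales it by the linear part, and the offset
  \<open>b u\<close> cancels. An equation between remainders is used so that it can serve as a
  rewrite rule.\<close>

lemma affine_action_wconj:
  assumes "[a u * a' u = 1] (mod N)" and "a x = 1"
  shows "affine_action a a' b (wconj (wpow u 1) (wpow x 1)) z mod N = (z + a u * b x) mod N"
proof -
  have eq: "affine_action a a' b (wconj (wpow u 1) (wpow x 1)) z = a u * a' u * (z - b u) + (a u * b x + b u)"
    using assms(2) by (simp add: wconj_def winv_def wpow_def algebra_simps)
  have "[a u * a' u * (z - b u) + (a u * b x + b u) = 1 * (z - b u) + (a u * b x + b u)] (mod N)"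
    by (intro cong_add cong_mult assms(1) cong_refl)
  moreover have "1 * (z - b u) + (a u * b x + b u) = z + a u * b x" by simp
  ultimately show ?thesis unfolding cong_def eq by (simp only:)
qed

text \<open>If x acts as translation by 1, then x^m sends 0 to m while x sends 0 to 1.\<close>

lemma generator_pow_neq:
  assumes "\<And>x. [a x * a' x = 1] (mod int N)"
    and "\<And>l r z. (l, r) \<in> Rel \<Longrightarrow> [affine_action a a' b l z = affine_action a a' b r z] (mod int N)"
    and "a x = 1" "b x = 1" and m: "\<not> [m = 1] (mod N)"
  shows "generator Rel x [^]\<^bsub>presented_group Rel\<^esub> m \<noteq> generator Rel x"
proof
  interpret group "presented_group Rel" by (rule group_presented_group)
  assume "generator Rel x [^]\<^bsub>presented_group Rel\<^esub> m = generator Rel x"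
  then have "word_class Rel (wpow x m) = word_class Rel (wpow x 1)"
    by (simp add: word_class_wpow)
  then have "word_cong Rel (wpow x m) (wpow x 1)"
    by (simp only: word_class_eq_iff)
  then have "[affine_action a a' b (wpow x m) 0 = affine_action a a' b (wpow x 1) 0] (mod int N)"
    by (rule word_cong_affine_action [where a = a and a' = a', rotated 2]) (fact assms(1), rule assms(2))
  then have "[int m = int 1] (mod int N)"
    using assms(3,4) by (simp add: affine_action_wpow del: One_nat_def)
  then show False using m by (simp only: cong_int_iff)
qed

lemma cong_mult_power_diff_1:
  assumes "[m ^ p = 1] (mod N)" "p > (0::nat)"
  shows "[int m * int m ^ (p - 1) = 1] (mod int N)"
proof -
  have "int m * int m ^ (p - 1) = int (m ^ p)"
    using assms(2) by (simp flip: power_Suc)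
  then show ?thesis using assms(1) by (metis cong_int_iff of_nat_1)
qed

text \<open>The five presentations are instances: x and y name the letters generating K, u the
  conjugating letter, and \<open>x'\<close>, \<open>y'\<close> the right sides of the conjugation
  relations. Admitting x = y brings in case (1), where K has one generator.\<close>

lemma quasitriangular_presented_group:
  fixes Rel :: "('x word \<times> 'x word) set" and \<chi> :: "'x word set \<Rightarrow> 'x word set \<Rightarrow> 'k::field_char_0"
  defines "G \<equiv> presented_group Rel"
  assumes UNIV: "UNIV = {x, y, u}"
    and p: "prime p" and N: "coprime p N" "N > 0"
    and pow: "(wpow x N, []) \<in> Rel" "(wpow y N, []) \<in> Rel" "(wpow u p, []) \<in> Rel"
    and comm: "x = y \<or> (wconj (wpow y 1) (wpow x 1), wpow x 1) \<in> Rel"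
    and x': "(wconj (wpow u 1) (wpow x 1), x') \<in> Rel" and y': "(wconj (wpow u 1) (wpow y 1), y') \<in> Rel"
    and s: "s = generator Rel x" and t: "t = generator Rel y" and v: "v = generator Rel u"
    and s': "s' = word_class Rel x'" and t': "t' = word_class Rel y'"
    and conj: "s' \<in> generate G {s, t}" "t' \<in> generate G {s, t}"
    and noncentral: "s' \<noteq> s \<or> t' \<noteq> t"
    and \<chi>: "char_identification G (generate G {s, t}) v \<chi>"
  shows "{R. quasitriangular G R} =
    {R_of (generate G {s, t}) \<chi> w |w. bicharacter G (generate G {s, t}) w \<and>
      w s' s' = w s s \<and> w s' t' = w s t \<and> w t' s' = w t s \<and> w t' t' = w t t}"
proof -
  interpret group G unfolding G_def by (rule group_presented_group)
  have gens: "s \<in> carrier G" "t \<in> carrier G" "v \<in> carrier G"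
    by (simp_all add: s t v G_def)
  have pow': "s [^]\<^bsub>G\<^esub> N = \<one>\<^bsub>G\<^esub>" "t [^]\<^bsub>G\<^esub> N = \<one>\<^bsub>G\<^esub>" "v [^]\<^bsub>G\<^esub> p = \<one>\<^bsub>G\<^esub>"
    using pow [THEN presented_group_relation]
    by (simp_all add: s t v G_def word_class_wpow presented_group_one)
  have wconj: "word_class Rel (wconj (wpow a 1) (wpow b 1)) =
      generator Rel a \<otimes>\<^bsub>G\<^esub> generator Rel b \<otimes>\<^bsub>G\<^esub> inv\<^bsub>G\<^esub> generator Rel a" for a b
    unfolding word_class_wconj word_class_wpow_1 G_def ..
  have st: "s \<otimes>\<^bsub>G\<^esub> t = t \<otimes>\<^bsub>G\<^esub> s"
  proof (cases "x = y")
    case True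
    then show ?thesis by (simp add: s t)
  next
    case False
    then have "t \<otimes>\<^bsub>G\<^esub> s \<otimes>\<^bsub>G\<^esub> inv\<^bsub>G\<^esub> t = word_class Rel (wpow x 1)"
      using comm presented_group_relation wconj s t by metis
    also have "\<dots> = s"
      unfolding word_class_wpow_1 s ..
    finally show ?thesis using gens by (metis inv_solve_right' m_closed)
  qed
  have sc: "v \<otimes>\<^bsub>G\<^esub> s \<otimes>\<^bsub>G\<^esub> inv\<^bsub>G\<^esub> v = s'" and tc: "v \<otimes>\<^bsub>G\<^esub> t \<otimes>\<^bsub>G\<^esub> inv\<^bsub>G\<^esub> v = t'"
    using x' y' presented_group_relation wconj s t v s' t' by metis+
  have "range (generator Rel) = {s, t, v}"
    by (simp add: UNIV s t v)
  then have generated: "carrier G \<subseteq> generate G {s, t, v}"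
    using presented_group_generated [of Rel] by (simp add: G_def)
  have "coprime_extension G (generate G {s, t}) v p N"
    using conj noncentral
    by (intro coprime_extension_two_generators p N gens st pow' generated) (simp_all add: sc tc)
  then show ?thesis
    using gens(1,2) sc tc \<chi> by (rule quasitriangular_two_generators)
qed

text \<open>\<open>S2\<close> is listed twice to stand for both x and y in
  \<open>quasitriangular_presented_group\<close>.\<close>

lemma UNIV_gen2: "UNIV = {S2, S2, T2}" and UNIV_gen3: "UNIV = {S3, T3, U3}"
  by (auto intro: gen2.exhaust gen3.exhaust)

lemma pow_in_generate:
  assumes "group G" "X \<subseteq> carrier G" "x \<in> X"
  shows "x [^]\<^bsub>G\<^esub> (n::nat) \<in> generate G X"
proof -
  interpret group G by fact
  show ?thesis by (induction n) (use assms(3) in \<open>auto intro: generate.intros\<close>)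
qed

section \<open>Nontriviality of the conjugation action in the presented groups\<close>

lemma rels3_noncentral:
  assumes m: "[m ^ p = 1] (mod q\<^sup>2)" "p > 0" "\<not> [m = 1] (mod q\<^sup>2)"
  shows "generator (rels3 p q m) S2 [^]\<^bsub>presented_group (rels3 p q m)\<^esub> m \<noteq> generator (rels3 p q m) S2"
proof -
  \<comment> \<open>The model on the integers modulo q^2: s is z \<mapsto> z + 1 and t is z
    \<mapsto> m z, with m^(p-1) as inverse multiplier. Then t s t^-1 is translation by m.\<close>
  define a a' b where "a = case_gen2 1 (int m)" and "a' = case_gen2 1 (int m ^ (p - 1))"
    and "b = case_gen2 (1::int) 0"
  have ab: "a S2 = 1" "a T2 = int m" "b S2 = 1" "b T2 = 0" "a' S2 = 1" "a' T2 = int m ^ (p - 1)"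
    by (simp_all add: a_def a'_def b_def)
  have aa': "[a x * a' x = 1] (mod int (q\<^sup>2))" for x
    using cong_mult_power_diff_1 [OF m(1,2)] by (cases x) (simp_all add: ab)
  have mp: "[int m ^ p * z = z] (mod int (q\<^sup>2))" for z
    using cong_scalar_right [of "int m ^ p" 1 "int (q\<^sup>2)" z] m(1)
    by (metis cong_int_iff mult_1 of_nat_1 of_nat_power)
  show ?thesis
  proof (rule generator_pow_neq [where a = a and a' = a' and b = b, OF aa' _ ab(1,3) m(3)])
    fix l r z assume "(l, r) \<in> rels3 p q m"
    then show "[affine_action a a' b l z = affine_action a a' b r z] (mod int (q\<^sup>2))"
      using mp [of z] unfolding cong_def rels3_def
      by (auto simp: affine_action_wconj [where a = a and a' = a', OF aa'] affine_action_wpow ab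
        simp del: of_nat_power One_nat_def)
  qed
qed

text \<open>Here s and t are translations and u is multiplication by m modulo q. The step widths
  \<open>b\<close> stay open, since the families need different generators to survive in the
  model.\<close>

lemma gen3_affine_relations:
  fixes m n :: nat
  assumes m: "[m ^ p = 1] (mod q)" "p > 0"
  defines "a \<equiv> case_gen3 1 1 (int m)" and "a' \<equiv> case_gen3 1 1 (int m ^ (p - 1))"
  shows "[a x * a' x = 1] (mod int q)"
    and "x \<noteq> U3 \<Longrightarrow> affine_action a a' b (wpow x k) z mod int q = (z + int k * b x) mod int q"
    and "b U3 = 0 \<Longrightarrow> affine_action a a' b (wpow U3 p) z mod int q = z mod int q"
    and "x \<noteq> U3 \<Longrightarrow> affine_action a a' b (wconj (wpow y 1) (wpow x 1)) z mod int q = (z + a y * b x) mod int q"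
proof -
  show aa': "[a x * a' x = 1] (mod int q)" for x
    using cong_mult_power_diff_1 [OF m] by (cases x) (simp_all add: a_def a'_def)
  have mp: "[int m ^ p * z = z] (mod int q)"
    using cong_scalar_right [of "int m ^ p" 1 "int q" z] m(1)
    by (metis cong_int_iff mult_1 of_nat_1 of_nat_power)
  have ax: "a x = 1" if "x \<noteq> U3" for x
    using that by (cases x) (simp_all add: a_def)
  show "x \<noteq> U3 \<Longrightarrow> affine_action a a' b (wpow x k) z mod int q = (z + int k * b x) mod int q"
    by (simp add: affine_action_wpow ax)
  show "b U3 = 0 \<Longrightarrow> affine_action a a' b (wpow U3 p) z mod int q = z mod int q"
    using mp by (simp add: affine_action_wpow cong_def a_def)
  show "x \<noteq> U3 \<Longrightarrow> affine_action a a' b (wconj (wpow y 1) (wpow x 1)) z mod int q = (z + a y * b x) mod int q"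
    using affine_action_wconj [of a y a' "int q" x, OF aa' ax] .
qed

text \<open>As u commutes with s and scales t, the model lets s act as the identity and t as
  translation by 1.\<close>

lemma rels4_noncentral:
  assumes m: "[m ^ p = 1] (mod q)" "p > 0" "\<not> [m = 1] (mod q)"
  shows "generator (rels4 p q m) T3 [^]\<^bsub>presented_group (rels4 p q m)\<^esub> m \<noteq> generator (rels4 p q m) T3"
  by (rule generator_pow_neq [where a = "case_gen3 1 1 (int m)" and a' = "case_gen3 1 1 (int m ^ (p - 1))" and b = "case_gen3 0 1 0",
      OF gen3_affine_relations(1) [OF m(1,2)] _ _ _ m(3)])
    (auto simp: rels4_def cong_def gen3_affine_relations(2-4) [OF m(1,2)] simp del: One_nat_def)

text \<open>Now s is translation by 1 and t acts as the identity, which makes the relations on t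
  hold trivially.\<close>

lemma rels5_noncentral:
  assumes m: "[m ^ p = 1] (mod q)" "p > 0" "\<not> [m = 1] (mod q)"
  shows "generator (rels5 p q m) S3 [^]\<^bsub>presented_group (rels5 p q m)\<^esub> m \<noteq> generator (rels5 p q m) S3"
  by (rule generator_pow_neq [where a = "case_gen3 1 1 (int m)" and a' = "case_gen3 1 1 (int m ^ (p - 1))" and b = "case_gen3 1 0 0",
      OF gen3_affine_relations(1) [OF m(1,2)] _ _ _ m(3)])
    (auto simp: rels5_def cong_def gen3_affine_relations(2-4) [OF m(1,2)] simp del: One_nat_def)

text \<open>The model used for \<open>rels5\<close> still works: t acts as the identity, hence so
  does t^n for every n.\<close>

lemma rels6_noncentral:
  assumes m: "[m ^ p = 1] (mod q)" "p > 0" "\<not> [m = 1] (mod q)"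
  shows "generator (rels6 p q m n) S3 [^]\<^bsub>presented_group (rels6 p q m n)\<^esub> m \<noteq> generator (rels6 p q m n) S3"
  by (rule generator_pow_neq [where a = "case_gen3 1 1 (int m)" and a' = "case_gen3 1 1 (int m ^ (p - 1))" and b = "case_gen3 1 0 0",
      OF gen3_affine_relations(1) [OF m(1,2)] _ _ _ m(3)])
    (auto simp: rels6_def cong_def gen3_affine_relations(2-4) [OF m(1,2)] simp del: One_nat_def)

text \<open>Here m and n are controlled only through the order of the group. If t = s, then u s u^-1
  = t = s, so the group is generated by the commuting elements s and u and has at most p q elements,
  fewer than p q^2.\<close>

lemma rels7_noncentral:
  assumes card: "card (carrier (presented_group (rels7 p q m n))) = p * q\<^sup>2"
    and "p > 0" "q > 1"
  shows "generator (rels7 p q m n) T3 \<noteq> generator (rels7 p q m n) S3"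
proof
  let ?R = "rels7 p q m n" and ?G = "presented_group (rels7 p q m n)"
  let ?s = "generator ?R S3" and ?u = "generator ?R U3"
  interpret group ?G by (rule group_presented_group)
  assume eq: "generator ?R T3 = ?s"
  have "(wpow S3 q, []) \<in> ?R" "(wpow U3 p, []) \<in> ?R" "(wconj (wpow U3 1) (wpow S3 1), wpow T3 1) \<in> ?R"
    by (simp_all add: rels7_def)
  from this [THEN presented_group_relation]
  have rel: "?s [^]\<^bsub>?G\<^esub> q = \<one>\<^bsub>?G\<^esub>" "?u [^]\<^bsub>?G\<^esub> p = \<one>\<^bsub>?G\<^esub>" "?u \<otimes>\<^bsub>?G\<^esub> ?s \<otimes>\<^bsub>?G\<^esub> inv\<^bsub>?G\<^esub> ?u = ?s"
    unfolding word_class_wconj word_class_wpow_1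
    unfolding word_class_wpow by (simp_all add: presented_group_one eq)
  then have su: "?s \<otimes>\<^bsub>?G\<^esub> ?u = ?u \<otimes>\<^bsub>?G\<^esub> ?s"
    by (metis generator_in_carrier inv_solve_right' m_closed)
  have "range (generator ?R) = {?s, ?u}"
    by (auto simp: UNIV_gen3 eq)
  then have "carrier ?G \<subseteq> generate ?G {?s, ?u}"
    using presented_group_generated [of ?R] by simp
  also have "\<dots> \<subseteq> (\<lambda>(i, j). ?s [^]\<^bsub>?G\<^esub> i \<otimes>\<^bsub>?G\<^esub> ?u [^]\<^bsub>?G\<^esub> j) ` ({..<q} \<times> {..<p})"
    using assms(2,3) by (intro generate_two_commuting rel su) simp_all
  finally have "card (carrier ?G) \<le> card ({..<q} \<times> {..<p})"
    by (meson card_image_le card_mono finite_SigmaI finite_imageI finite_lessThan le_trans)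
  then show False
    using card assms(2,3) by (simp add: power2_eq_square)
qed

section \<open>The five families of groups\<close>

lemma quasitriangular_beta3:
  fixes \<chi> :: "_ \<Rightarrow> _ \<Rightarrow> 'k::field_char_0"
  assumes "prime p" "prime q" "p \<noteq> q" "[m ^ p = 1] (mod q\<^sup>2)" "\<not> [m = 1] (mod q\<^sup>2)"
    and rel: "rel = rels3 p q m" and G: "G = presented_group rel"
    and s: "s = generator rel S2" and t: "t = generator rel T2"
    and \<chi>: "char_identification G (generate G {s}) t \<chi>"
  shows "{R. quasitriangular G R} = {R_of (generate G {s}) \<chi> w |w. bicharacter G (generate G {s}) w \<and>
    w (s [^]\<^bsub>G\<^esub> m) (s [^]\<^bsub>G\<^esub> m) = w s s}"
proof -
  have p: "p > 0" "coprime p (q\<^sup>2)" "q\<^sup>2 > 0"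
    using assms(1-3) primes_coprime [of p q] by (simp_all add: prime_gt_0_nat)
  have rels: "(wpow S2 (q\<^sup>2), []) \<in> rel" "(wpow T2 p, []) \<in> rel"
    "(wconj (wpow T2 1) (wpow S2 1), wpow S2 m) \<in> rel"
    by (simp_all add: rel rels3_def)
  interpret group G unfolding G by (rule group_presented_group)
  have carrier: "s \<in> carrier G"
    by (simp add: s G)
  have K: "s [^]\<^bsub>G\<^esub> m \<in> generate G {s, s}"
    using carrier by (auto intro!: pow_in_generate)
  have classes: "s [^]\<^bsub>G\<^esub> m = word_class rel (wpow S2 m)"
    unfolding word_class_wpow s G ..
  have noncentral: "s [^]\<^bsub>G\<^esub> m \<noteq> s \<or> s [^]\<^bsub>G\<^esub> m \<noteq> s"
    unfolding s G rel using rels3_noncentral assms(4,5) p by blast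
  have "char_identification G (generate G {s, s}) t \<chi>"
    using \<chi> by simp
  \<comment> \<open>With t = s the four conditions on w coincide, and the repeated generator
    disappears by simplification.\<close>
  from quasitriangular_presented_group [OF UNIV_gen2 assms(1) p(2,3) rels(1,1,2) disjI1 [OF refl]
      rels(3,3) s s t classes [unfolded G] classes [unfolded G], folded G, OF K K noncentral this]
  show ?thesis by simp
qed

lemma quasitriangular_beta4:
  fixes \<chi> :: "_ \<Rightarrow> _ \<Rightarrow> 'k::field_char_0"
  assumes "prime p" "prime q" "p \<noteq> q" "[m ^ p = 1] (mod q)" "\<not> [m = 1] (mod q)"
    and rel: "rel = rels4 p q m" and G: "G = presented_group rel"
    and s: "s = generator rel S3" and t: "t = generator rel T3" and u: "u = generator rel U3"
    and \<chi>: "char_identification G (generate G {s, t}) u \<chi>"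
  shows "{R. quasitriangular G R} =
    {R_of (generate G {s, t}) \<chi> w |w. bicharacter G (generate G {s, t}) w \<and>
      w s (t [^]\<^bsub>G\<^esub> m) = w s t \<and>
      w (t [^]\<^bsub>G\<^esub> m) s = w t s \<and>
      w (t [^]\<^bsub>G\<^esub> m) (t [^]\<^bsub>G\<^esub> m) = w t t}"
proof -
  have p: "p > 0" "coprime p q" "q > 0" "q > 1"
    using assms(1-3) primes_coprime [of p q] prime_gt_1_nat [of q] by (simp_all add: prime_gt_0_nat)
  have rels: "(wpow S3 q, []) \<in> rel" "(wpow T3 q, []) \<in> rel" "(wpow U3 p, []) \<in> rel"
    "(wconj (wpow T3 1) (wpow S3 1), wpow S3 1) \<in> rel"
    "(wconj (wpow U3 1) (wpow S3 1), wpow S3 1) \<in> rel" "(wconj (wpow U3 1) (wpow T3 1), wpow T3 m) \<in> rel"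
    by (simp_all add: rel rels4_def)
  interpret group G unfolding G by (rule group_presented_group)
  have carrier: "s \<in> carrier G" "t \<in> carrier G"
    by (simp_all add: s t G)
  have K: "s \<in> generate G {s, t}" "t [^]\<^bsub>G\<^esub> m \<in> generate G {s, t}"
    using carrier by (auto intro!: pow_in_generate intro: generate.incl generate.eng)
  have classes: "s = word_class rel (wpow S3 1)" "t [^]\<^bsub>G\<^esub> m = word_class rel (wpow T3 m)"
    unfolding word_class_append word_class_wpow s [symmetric] t [symmetric] G [symmetric]
    using carrier by simp_all
  \<comment> \<open>Since u fixes s, only t can witness noncentrality. For the same reason the
    condition on w at (s, s) becomes trivial and three remain.\<close>
  have noncentral: "s \<noteq> s \<or> t [^]\<^bsub>G\<^esub> m \<noteq> t"
    unfolding s t G rel using rels4_noncentral assms(4,5) p by blast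
  from quasitriangular_presented_group [OF UNIV_gen3 assms(1) p(2,3) rels(1-3) disjI2 [OF rels(4)]
      rels(5,6) s t u classes [unfolded G], folded G, OF K noncentral \<chi>]
  show ?thesis by simp
qed

lemma quasitriangular_beta5:
  fixes \<chi> :: "_ \<Rightarrow> _ \<Rightarrow> 'k::field_char_0"
  assumes "prime p" "prime q" "p \<noteq> q" "[m ^ p = 1] (mod q)" "\<not> [m = 1] (mod q)"
    and rel: "rel = rels5 p q m" and G: "G = presented_group rel"
    and s: "s = generator rel S3" and t: "t = generator rel T3" and u: "u = generator rel U3"
    and \<chi>: "char_identification G (generate G {s, t}) u \<chi>"
  shows "{R. quasitriangular G R} =
    {R_of (generate G {s, t}) \<chi> w |w. bicharacter G (generate G {s, t}) w \<and>
      w (s [^]\<^bsub>G\<^esub> m) (s [^]\<^bsub>G\<^esub> m) = w s s \<and>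
      w (s [^]\<^bsub>G\<^esub> m) (t [^]\<^bsub>G\<^esub> m) = w s t \<and>
      w (t [^]\<^bsub>G\<^esub> m) (s [^]\<^bsub>G\<^esub> m) = w t s \<and>
      w (t [^]\<^bsub>G\<^esub> m) (t [^]\<^bsub>G\<^esub> m) = w t t}"
proof -
  have p: "p > 0" "coprime p q" "q > 0" "q > 1"
    using assms(1-3) primes_coprime [of p q] prime_gt_1_nat [of q] by (simp_all add: prime_gt_0_nat)
  have rels: "(wpow S3 q, []) \<in> rel" "(wpow T3 q, []) \<in> rel" "(wpow U3 p, []) \<in> rel"
    "(wconj (wpow T3 1) (wpow S3 1), wpow S3 1) \<in> rel"
    "(wconj (wpow U3 1) (wpow S3 1), wpow S3 m) \<in> rel" "(wconj (wpow U3 1) (wpow T3 1), wpow T3 m) \<in> rel"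
    by (simp_all add: rel rels5_def)
  interpret group G unfolding G by (rule group_presented_group)
  have carrier: "s \<in> carrier G" "t \<in> carrier G"
    by (simp_all add: s t G)
  have K: "s [^]\<^bsub>G\<^esub> m \<in> generate G {s, t}" "t [^]\<^bsub>G\<^esub> m \<in> generate G {s, t}"
    using carrier by (auto intro!: pow_in_generate intro: generate.incl generate.eng)
  have classes: "s [^]\<^bsub>G\<^esub> m = word_class rel (wpow S3 m)" "t [^]\<^bsub>G\<^esub> m = word_class rel (wpow T3 m)"
    unfolding word_class_append word_class_wpow s [symmetric] t [symmetric] G [symmetric]
    using carrier by simp_all
  have noncentral: "s [^]\<^bsub>G\<^esub> m \<noteq> s \<or> t [^]\<^bsub>G\<^esub> m \<noteq> t"
    unfolding s t G rel using rels5_noncentral assms(4,5) p by blast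
  from quasitriangular_presented_group [OF UNIV_gen3 assms(1) p(2,3) rels(1-3) disjI2 [OF rels(4)]
      rels(5,6) s t u classes [unfolded G], folded G, OF K noncentral \<chi>]
  show ?thesis by simp
qed

lemma quasitriangular_beta6:
  fixes \<chi> :: "_ \<Rightarrow> _ \<Rightarrow> 'k::field_char_0"
  assumes "prime p" "prime q" "p \<noteq> q" "[m ^ p = 1] (mod q)" "\<not> [m = 1] (mod q)"
    and rel: "rel = rels6 p q m n" and G: "G = presented_group rel"
    and s: "s = generator rel S3" and t: "t = generator rel T3" and u: "u = generator rel U3"
    and \<chi>: "char_identification G (generate G {s, t}) u \<chi>"
  shows "{R. quasitriangular G R} =
    {R_of (generate G {s, t}) \<chi> w |w. bicharacter G (generate G {s, t}) w \<and>
      w (s [^]\<^bsub>G\<^esub> m) (s [^]\<^bsub>G\<^esub> m) = w s s \<and>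
      w (s [^]\<^bsub>G\<^esub> m) (t [^]\<^bsub>G\<^esub> n) = w s t \<and>
      w (t [^]\<^bsub>G\<^esub> n) (s [^]\<^bsub>G\<^esub> m) = w t s \<and>
      w (t [^]\<^bsub>G\<^esub> n) (t [^]\<^bsub>G\<^esub> n) = w t t}"
proof -
  have p: "p > 0" "coprime p q" "q > 0" "q > 1"
    using assms(1-3) primes_coprime [of p q] prime_gt_1_nat [of q] by (simp_all add: prime_gt_0_nat)
  have rels: "(wpow S3 q, []) \<in> rel" "(wpow T3 q, []) \<in> rel" "(wpow U3 p, []) \<in> rel"
    "(wconj (wpow T3 1) (wpow S3 1), wpow S3 1) \<in> rel"
    "(wconj (wpow U3 1) (wpow S3 1), wpow S3 m) \<in> rel" "(wconj (wpow U3 1) (wpow T3 1), wpow T3 n) \<in> rel"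
    by (simp_all add: rel rels6_def)
  interpret group G unfolding G by (rule group_presented_group)
  have carrier: "s \<in> carrier G" "t \<in> carrier G"
    by (simp_all add: s t G)
  have K: "s [^]\<^bsub>G\<^esub> m \<in> generate G {s, t}" "t [^]\<^bsub>G\<^esub> n \<in> generate G {s, t}"
    using carrier by (auto intro!: pow_in_generate intro: generate.incl generate.eng)
  have classes: "s [^]\<^bsub>G\<^esub> m = word_class rel (wpow S3 m)" "t [^]\<^bsub>G\<^esub> n = word_class rel (wpow T3 n)"
    unfolding word_class_append word_class_wpow s [symmetric] t [symmetric] G [symmetric]
    using carrier by simp_all
  have noncentral: "s [^]\<^bsub>G\<^esub> m \<noteq> s \<or> t [^]\<^bsub>G\<^esub> n \<noteq> t"
    unfolding s t G rel using rels6_noncentral assms(4,5) p by blast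
  from quasitriangular_presented_group [OF UNIV_gen3 assms(1) p(2,3) rels(1-3) disjI2 [OF rels(4)]
      rels(5,6) s t u classes [unfolded G], folded G, OF K noncentral \<chi>]
  show ?thesis by simp
qed

lemma quasitriangular_beta7:
  fixes \<chi> :: "_ \<Rightarrow> _ \<Rightarrow> 'k::field_char_0"
  assumes "prime p" "prime q" "p \<noteq> q" 
    "card (carrier (presented_group (rels7 p q m n))) = p * q\<^sup>2"
    and rel: "rel = rels7 p q m n" and G: "G = presented_group rel"
    and s: "s = generator rel S3" and t: "t = generator rel T3" and u: "u = generator rel U3"
    and \<chi>: "char_identification G (generate G {s, t}) u \<chi>"
  shows "{R. quasitriangular G R} =
    {R_of (generate G {s, t}) \<chi> w |w. bicharacter G (generate G {s, t}) w \<and>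
      w t t = w s s \<and>
      w t (s [^]\<^bsub>G\<^esub> m \<otimes>\<^bsub>G\<^esub> t [^]\<^bsub>G\<^esub> n) = w s t \<and>
      w (s [^]\<^bsub>G\<^esub> m \<otimes>\<^bsub>G\<^esub> t [^]\<^bsub>G\<^esub> n) t = w t s \<and>
      w (s [^]\<^bsub>G\<^esub> m \<otimes>\<^bsub>G\<^esub> t [^]\<^bsub>G\<^esub> n) (s [^]\<^bsub>G\<^esub> m \<otimes>\<^bsub>G\<^esub> t [^]\<^bsub>G\<^esub> n) = w t t}"
proof -
  have p: "p > 0" "coprime p q" "q > 0" "q > 1"
    using assms(1-3) primes_coprime [of p q] prime_gt_1_nat [of q] by (simp_all add: prime_gt_0_nat)
  have rels: "(wpow S3 q, []) \<in> rel" "(wpow T3 q, []) \<in> rel" "(wpow U3 p, []) \<in> rel"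
    "(wconj (wpow T3 1) (wpow S3 1), wpow S3 1) \<in> rel"
    "(wconj (wpow U3 1) (wpow S3 1), wpow T3 1) \<in> rel" "(wconj (wpow U3 1) (wpow T3 1), wpow S3 m @ wpow T3 n) \<in> rel"
    by (simp_all add: rel rels7_def)
  interpret group G unfolding G by (rule group_presented_group)
  have carrier: "s \<in> carrier G" "t \<in> carrier G"
    by (simp_all add: s t G)
  have K: "t \<in> generate G {s, t}" "s [^]\<^bsub>G\<^esub> m \<otimes>\<^bsub>G\<^esub> t [^]\<^bsub>G\<^esub> n \<in> generate G {s, t}"
    using carrier by (auto intro!: pow_in_generate intro: generate.incl generate.eng)
  have classes: "t = word_class rel (wpow T3 1)" "s [^]\<^bsub>G\<^esub> m \<otimes>\<^bsub>G\<^esub> t [^]\<^bsub>G\<^esub> n = word_class rel (wpow S3 m @ wpow T3 n)"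
    unfolding word_class_append word_class_wpow s [symmetric] t [symmetric] G [symmetric]
    using carrier by simp_all
  \<comment> \<open>Conjugation by u carries s to t, so u moves s exactly when t \<noteq> s.\<close>
  have noncentral: "t \<noteq> s \<or> s [^]\<^bsub>G\<^esub> m \<otimes>\<^bsub>G\<^esub> t [^]\<^bsub>G\<^esub> n \<noteq> t"
    unfolding s t G rel using rels7_noncentral assms(4) p by blast
  from quasitriangular_presented_group [OF UNIV_gen3 assms(1) p(2,3) rels(1-3) disjI2 [OF rels(4)]
      rels(5,6) s t u classes [unfolded G], folded G, OF K noncentral \<chi>]
  show ?thesis by simp
qed

theorem proposition4p5:
  fixes p q :: nat
  assumes "prime p" and "odd p" and "prime q" and "odd q" and "p < q"
  shows
    "(\<forall>(m::nat) (\<chi> :: _ \<Rightarrow> _ \<Rightarrow> 'k::{alg_closed_field, field_char_0}).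
       p dvd q\<^sup>2 - 1 \<and> [m ^ p = 1] (mod q\<^sup>2) \<and> \<not> [m = 1] (mod q\<^sup>2) \<longrightarrow>
       (let rel = rels3 p q m; G = presented_group rel;
           s = generator rel S2; t = generator rel T2;
           K = generate G {s}
       in char_identification G K t \<chi> \<longrightarrow>
          {R. quasitriangular G R} =
          {R_of K \<chi> w |w. bicharacter G K w \<and>
              w (s [^]\<^bsub>G\<^esub> m) (s [^]\<^bsub>G\<^esub> m) = w s s})) \<and>
     (\<forall>(m::nat) (\<chi> :: _ \<Rightarrow> _ \<Rightarrow> 'k::{alg_closed_field, field_char_0}).
       p dvd q - 1 \<and> [m ^ p = 1] (mod q) \<and> \<not> [m = 1] (mod q) \<longrightarrow>
       (let rel = rels4 p q m; G = presented_group rel;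
           s = generator rel S3; t = generator rel T3; u = generator rel U3;
           K = generate G {s, t}
       in char_identification G K u \<chi> \<longrightarrow>
          {R. quasitriangular G R} =
          {R_of K \<chi> w |w. bicharacter G K w \<and>
              w s (t [^]\<^bsub>G\<^esub> m) = w s t \<and>
              w (t [^]\<^bsub>G\<^esub> m) s = w t s \<and>
              w (t [^]\<^bsub>G\<^esub> m) (t [^]\<^bsub>G\<^esub> m) = w t t})) \<and>
     (\<forall>(m::nat) (\<chi> :: _ \<Rightarrow> _ \<Rightarrow> 'k::{alg_closed_field, field_char_0}).
       p dvd q - 1 \<and> [m ^ p = 1] (mod q) \<and> \<not> [m = 1] (mod q) \<longrightarrow>
       (let rel = rels5 p q m; G = presented_group rel;
           s = generator rel S3; t = generator rel T3; u = generator rel U3;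
           K = generate G {s, t}
       in char_identification G K u \<chi> \<longrightarrow>
          {R. quasitriangular G R} =
          {R_of K \<chi> w |w. bicharacter G K w \<and>
              w (s [^]\<^bsub>G\<^esub> m) (s [^]\<^bsub>G\<^esub> m) = w s s \<and>
              w (s [^]\<^bsub>G\<^esub> m) (t [^]\<^bsub>G\<^esub> m) = w s t \<and>
              w (t [^]\<^bsub>G\<^esub> m) (s [^]\<^bsub>G\<^esub> m) = w t s \<and>
              w (t [^]\<^bsub>G\<^esub> m) (t [^]\<^bsub>G\<^esub> m) = w t t})) \<and>
     (\<forall>(m::nat) (n::nat) (\<chi> :: _ \<Rightarrow> _ \<Rightarrow> 'k::{alg_closed_field, field_char_0}).
       p dvd q - 1 \<and> [m ^ p = 1] (mod q) \<and> [n ^ p = 1] (mod q) \<and>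
       \<not> [m = 1] (mod q) \<and> \<not> [n = 1] (mod q) \<and> \<not> [m = n] (mod q) \<longrightarrow>
       (let rel = rels6 p q m n; G = presented_group rel;
           s = generator rel S3; t = generator rel T3; u = generator rel U3;
           K = generate G {s, t}
       in char_identification G K u \<chi> \<longrightarrow>
          {R. quasitriangular G R} =
          {R_of K \<chi> w |w. bicharacter G K w \<and>
              w (s [^]\<^bsub>G\<^esub> m) (s [^]\<^bsub>G\<^esub> m) = w s s \<and>
              w (s [^]\<^bsub>G\<^esub> m) (t [^]\<^bsub>G\<^esub> n) = w s t \<and>
              w (t [^]\<^bsub>G\<^esub> n) (s [^]\<^bsub>G\<^esub> m) = w t s \<and>
              w (t [^]\<^bsub>G\<^esub> n) (t [^]\<^bsub>G\<^esub> n) = w t t})) \<and>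
     (\<forall>(m::nat) (n::nat) (\<chi> :: _ \<Rightarrow> _ \<Rightarrow> 'k::{alg_closed_field, field_char_0}).
       p dvd q + 1 \<and> card (carrier (presented_group (rels7 p q m n))) = p * q\<^sup>2 \<longrightarrow>
       (let rel = rels7 p q m n; G = presented_group rel;
           s = generator rel S3; t = generator rel T3; u = generator rel U3;
           K = generate G {s, t}
       in char_identification G K u \<chi> \<longrightarrow>
          {R. quasitriangular G R} =
          {R_of K \<chi> w |w. bicharacter G K w \<and>
              w t t = w s s \<and>
              w t (s [^]\<^bsub>G\<^esub> m \<otimes>\<^bsub>G\<^esub> t [^]\<^bsub>G\<^esub> n) = w s t \<and>
              w (s [^]\<^bsub>G\<^esub> m \<otimes>\<^bsub>G\<^esub> t [^]\<^bsub>G\<^esub> n) t = w t s \<and>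
              w (s [^]\<^bsub>G\<^esub> m \<otimes>\<^bsub>G\<^esub> t [^]\<^bsub>G\<^esub> n) (s [^]\<^bsub>G\<^esub> m \<otimes>\<^bsub>G\<^esub> t [^]\<^bsub>G\<^esub> n) = w t t}))"
proof -
  have pq: "p \<noteq> q" using assms by simp
  show ?thesis
    unfolding Let_def
    by (intro conjI allI impI; (elim conjE)?;
      rule quasitriangular_beta3 [OF assms(1,3) pq] quasitriangular_beta4 [OF assms(1,3) pq]
        quasitriangular_beta5 [OF assms(1,3) pq] quasitriangular_beta6 [OF assms(1,3) pq]
        quasitriangular_beta7 [OF assms(1,3) pq]; (assumption | rule refl))
qed

end
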